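(* Let $G$ be a plane Hamiltonian convex geometric graph. If $G$ is not convex-isomorphic to any of $\mathcal{C}_3$, $\mathcal{C}_4$, $\Theta_1$, $\Theta_2$, $\Theta_3$, $\Theta_4$, then $G$ is not convex-packable. Moreover, each of $\mathcal{C}_3$, $\mathcal{C}_4$, $\Theta_1$, $\Theta_2$, $\Theta_3$, $\Theta_4$ is convex-packable.
   Context: Graphs are finite and simple; $e(G)$ is the number of edges of $G$. A convex geometric graph (CGG) is a graph whose vertices are points in strictly convex position in the Euclidean plane and whose edges are straight line segments joining vertices. Its vertices $v_0,\dots,v_{n-1}$ are listed in clockwise cyclic order on the boundary of their convex hull (indices modulo $n$). A pair $\{v_i,v_{i+1}\}$ is an extremal pair. The length $\ell(x,y)$ of a pair of vertices is the minimum length of a path from $x$ to $y$ using only extremal pairs. A CGG is plane if no two of its edges cross, and Hamiltonian if its underlying abstract graph contains a Hamiltonian cycle. CGGs $G_1,G_2$ are convex-isomorphic if there is a bijection $f:V(G_1)\to V(G_2)$ such that for all $x,y\in V(G_1)$: $\ell(x,y)=\ell(f(x),f(y))$ (lengths taken in $G_1$, resp. $G_2$), and $\{x,y\}\in E(G_1)$ if and only if $\{f(x),f(y)\}\in E(G_2)$. A subgraph of a CGG is regarded as a CGG on its own vertex set with the induced cyclic order. Let $\mathcal{K}_n$ be the complete CGG on $n$ vertices. A $G$-packing of $\mathcal{K}_n$ is a collection of pairwise edge-disjoint subgraphs of $\mathcal{K}_n$, each convex-isomorphic to $G$; $p(n,G)$ is the maximum size of such a packing. $G$ is convex-packable if $\lim_{n\to\infty}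 p(n,G)\,e(G)/\binom n2=1$, i.e. there are $G$-packings of $\mathcal{K}_n$ covering all but $o(n^2)$ edges. $\mathcal{C}_k$ is the convex plane $k$-cycle, i.e. $k$ points in convex position with the $k$ extremal pairs as edges. With vertices $1,\dots,k$ in cyclic order around the convex hull: - $\Theta_1$: $\mathcal{C}_4$ plus the chord $\{2,4\}$. - $\Theta_2$: $\mathcal{C}_5$ plus the chords $\{1,3\},\{1,4\}$. - $\Theta_3$: $\mathcal{C}_6$ plus the chords $\{2,4\},\{2,5\},\{1,5\}$. - $\Theta_4$: $\mathcal{C}_6$ plus the chords $\{2,4\},\{2,5\},\{2,6\}$. *)

theory Defs
  imports "HOL-Analysis.Analysis"
begin

text \<open>The Euclidean plane is the type \<^typ>\<open>complex\<close>; the edge joining \<open>x\<close> and \<open>y\<close> is recorded as the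
  two-element set \<open>{x, y}\<close> and drawn as the segment between its endpoints.\<close>

record cgg =
  verts :: "complex set"
  edges :: "complex set set"

definition strictly_convex_position :: "complex set \<Rightarrow> bool" where
  "strictly_convex_position V \<longleftrightarrow> (\<forall>x\<in>V. x \<notin> convex hull (V - {x}))"

definition convex_geometric_graph :: "cgg \<Rightarrow> bool" where
  "convex_geometric_graph G \<longleftrightarrow>
     finite (verts G) \<and> strictly_convex_position (verts G) \<and>
     (\<forall>e\<in>edges G. e \<subseteq> verts G \<and> card e = 2)"

text \<open>\<open>Im (cnj u * v)\<close> is the determinant of the plane vectors \<open>u\<close> and \<open>v\<close>.\<close>

definition clockwise_triple :: "complex \<Rightarrow> complex \<Rightarrow> complex \<Rightarrow> bool" where
  "clockwise_triple a b c \<longleftrightarrow> Im (cnj (b - a) * (c - a)) < 0"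

text \<open>A finite set in strictly convex position has exactly one such listing for each choice of the
  first vertex.\<close>

definition clockwise_listing :: "complex set \<Rightarrow> complex list \<Rightarrow> bool" where
  "clockwise_listing V vs \<longleftrightarrow>
     distinct vs \<and> set vs = V \<and>
     (\<forall>i j k. i < j \<and> j < k \<and> k < length vs \<longrightarrow> clockwise_triple (vs ! i) (vs ! j) (vs ! k))"

definition extremal_pairs :: "complex set \<Rightarrow> complex set set" where
  "extremal_pairs V =
     {{x, y} | x y. x \<noteq> y \<and>
        (\<exists>vs i. clockwise_listing V vs \<and> i < length vs \<and>
                x = vs ! i \<and> y = vs ! (Suc i mod length vs))}"

definition extremal_path :: "complex set \<Rightarrow> complex \<Rightarrow> complex \<Rightarrow> complex list \<Rightarrow> bool" where
  "extremal_path V x y p \<longleftrightarrow>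
     p \<noteq> [] \<and> hd p = x \<and> last p = y \<and> set p \<subseteq> V \<and> distinct p \<and>
     (\<forall>i. Suc i < length p \<longrightarrow> {p ! i, p ! Suc i} \<in> extremal_pairs V)"

definition pair_length :: "complex set \<Rightarrow> complex \<Rightarrow> complex \<Rightarrow> nat" where
  "pair_length V x y = (LEAST l. \<exists>p. extremal_path V x y p \<and> l = length p - 1)"

text \<open>Two edges with a common endpoint do not cross: their open segments are disjoint in strictly
  convex position.\<close>

definition plane :: "cgg \<Rightarrow> bool" where
  "plane G \<longleftrightarrow>
     (\<forall>a b c d. {a, b} \<in> edges G \<and> {c, d} \<in> edges G \<and> {a, b} \<noteq> {c, d} \<longrightarrow>
        open_segment a b \<inter> open_segment c d = {})"

definition hamiltonian :: "cgg \<Rightarrow> bool" where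
  "hamiltonian G \<longleftrightarrow>
     (\<exists>vs. length vs \<ge> 3 \<and> distinct vs \<and> set vs = verts G \<and>
        (\<forall>i<length vs. {vs ! i, vs ! (Suc i mod length vs)} \<in> edges G))"

definition convex_isomorphic :: "cgg \<Rightarrow> cgg \<Rightarrow> bool" where
  "convex_isomorphic G H \<longleftrightarrow>
     (\<exists>f. bij_betw f (verts G) (verts H) \<and>
        (\<forall>x\<in>verts G. \<forall>y\<in>verts G.
           pair_length (verts G) x y = pair_length (verts H) (f x) (f y) \<and>
           ({x, y} \<in> edges G \<longleftrightarrow> {f x, f y} \<in> edges H)))"

definition subgraph :: "cgg \<Rightarrow> cgg \<Rightarrow> bool" where
  "subgraph H G \<longleftrightarrow>
     convex_geometric_graph H \<and> verts H \<subseteq> verts G \<and> edges H \<subseteq> edges G"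

text \<open>All complete CGGs on \<open>n\<close> vertices are convex-isomorphic; the regular \<open>n\<close>-gon inscribed in the
  unit circle is taken as the representative vertex set.  Its vertices \<open>1, \<dots>, n\<close> run clockwise,
  whence the negative angle.\<close>

definition polygon_vertex :: "nat \<Rightarrow> nat \<Rightarrow> complex" where
  "polygon_vertex n i = cis (- (2 * pi * real i / real n))"

definition regular_polygon :: "nat \<Rightarrow> complex set" where
  "regular_polygon n = polygon_vertex n ` {1..n}"

definition complete_cgg :: "nat \<Rightarrow> cgg" where
  "complete_cgg n =
     \<lparr>verts = regular_polygon n, edges = {e. e \<subseteq> regular_polygon n \<and> card e = 2}\<rparr>"

definition packing :: "cgg \<Rightarrow> nat \<Rightarrow> cgg set \<Rightarrow> bool" where
  "packing G n P \<longleftrightarrow>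
     (\<forall>H\<in>P. subgraph H (complete_cgg n) \<and> convex_isomorphic H G) \<and>
     (\<forall>H\<in>P. \<forall>H'\<in>P. H \<noteq> H' \<longrightarrow> edges H \<inter> edges H' = {})"

definition packing_number :: "nat \<Rightarrow> cgg \<Rightarrow> nat" where
  "packing_number n G = Max (card ` {P. packing G n P})"

definition convex_packable :: "cgg \<Rightarrow> bool" where
  "convex_packable G \<longleftrightarrow>
     (\<lambda>n. real (packing_number n G) * real (card (edges G)) / real (n choose 2)) \<longlonglongrightarrow> 1"

definition convex_cycle :: "nat \<Rightarrow> cgg" where
  "convex_cycle k =
     \<lparr>verts = regular_polygon k, edges = extremal_pairs (regular_polygon k)\<rparr>"

text \<open>The convex cycle on vertices \<open>1, \<dots>, k\<close> with the chords \<open>{i, j}\<close>, \<open>(i, j) \<in> S\<close>, added.\<close>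

definition cycle_with_chords :: "nat \<Rightarrow> (nat \<times> nat) set \<Rightarrow> cgg" where
  "cycle_with_chords k S =
     \<lparr>verts = verts (convex_cycle k),
      edges = edges (convex_cycle k) \<union>
              (\<lambda>(i, j). {polygon_vertex k i, polygon_vertex k j}) ` S\<rparr>"

definition Theta1 :: cgg where "Theta1 = cycle_with_chords 4 {(2, 4)}"
definition Theta2 :: cgg where "Theta2 = cycle_with_chords 5 {(1, 3), (1, 4)}"
definition Theta3 :: cgg where "Theta3 = cycle_with_chords 6 {(2, 4), (2, 5), (1, 5)}"
definition Theta4 :: cgg where "Theta4 = cycle_with_chords 6 {(2, 4), (2, 5), (2, 6)}"

end

theory Submission imports Defs begin

text \<open>\<^emph>\<open>Obstruction.\<close>  A plane Hamiltonian CGG on \<open>k\<close> vertices consists of the hull cycle and \<open>m \<le> k - 3\<close>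
  chords.  Weigh a pair of vertices of \<open>\<K>\<^sub>n\<close> by its length truncated at \<open>t n\<close>.  The average weight is
  asymptotically \<open>t (1 - t) n\<close>, whereas a copy has weight at most \<open>n + m t n\<close>, since its hull lengths
  add up to at most \<open>n\<close>.  With \<open>t = k / (2 (k + m))\<close> this excludes packability if \<open>k\<^sup>2 > 4 (k + m)\<close>.  The
  only other case to be excluded is the hexagon with an inscribed triangle, whose chords also have total
  length at most \<open>n\<close>.

  \<^emph>\<open>Constructions.\<close>  Base copies whose edges have pairwise distinct lengths remain edge-disjoint under
  all rotations.  So it suffices to distribute almost all lengths among base copies, which is done by
  one or two families depending linearly on a parameter.\<close>

section \<open>Clockwise listings and extremal pairs\<close>

text \<open>In a nearly perfect packing the copies must have the average weight of all pairs, so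
  \<open>(1 + m t) / (k + m)\<close> is at least \<open>t (1 - t)\<close>, that is,
  \<open>k t - (k + m) t^2 <= 1\<close>. The left side is largest at
  \<open>t = k / (2 (k + m))\<close>, with value \<open>k^2 / (4 (k + m))\<close>. With
  \<open>m <= k - 3\<close> the pairs \<open>(k, m)\<close> that survive are (3,0), (4,0), (4,1),
  (5,2) and (6,3). Each belongs to one graph up to symmetry, except (6,3), where equality holds and
  three triangulations remain; this is why the inscribed triangle needs its own bound. For the
  constructions, the \<open>K\<close> cells of lengths up to half the circle match the number of
  base edges, so that disjointness of the swept lengths already makes the packing nearly perfect.
  Around a triangle the slopes, with suitable signs, add up to 0, hence they cannot all be odd.
  Every graph but the 4-cycle contains a triangle, so slopes 2 are unavoidable there; such an edge
  uses only half of its two cells, and an edge of the other parity must fill the rest, for which a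
  second family gives room. A convex isomorphism preserves lengths, not orientation; the obstruction
  uses only that it preserves length 1, the hull edges.\<close>

lemma clockwise_triple_alt:
  "clockwise_triple a b c \<longleftrightarrow>
     (Re b - Re a) * (Im c - Im a) - (Im b - Im a) * (Re c - Re a) < 0"
  unfolding clockwise_triple_def by (simp add: algebra_simps)

lemma clockwise_triple_rotate: "clockwise_triple a b c \<longleftrightarrow> clockwise_triple b c a"
  unfolding clockwise_triple_alt by (simp add: algebra_simps)

lemma clockwise_triple_antisym: "clockwise_triple a b c \<Longrightarrow> \<not> clockwise_triple a c b"
  unfolding clockwise_triple_alt by (simp add: algebra_simps)

text \<open>The directed line from \<open>x\<close> to \<open>y\<close> supports the convex hull:
  all other points lie strictly to its right.\<close>

definition clockwise_succ :: "complex set \<Rightarrow> complex \<Rightarrow> complex \<Rightarrow> bool" where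
  "clockwise_succ V x y \<longleftrightarrow> (\<forall>z\<in>V - {x, y}. clockwise_triple x y z)"

lemma clockwise_listing_succ:
  assumes L: "clockwise_listing V vs" and i: "i < length vs"
    and 2: "2 \<le> length vs"
  shows "clockwise_succ V (vs ! i) (vs ! (Suc i mod length vs))"
  unfolding clockwise_succ_def
proof
  fix z assume z: "z \<in> V - {vs ! i, vs ! (Suc i mod length vs)}"
  from L have tr: "\<And>i j k. i < j \<Longrightarrow> j < k \<Longrightarrow> k < length vs \<Longrightarrow>
      clockwise_triple (vs ! i) (vs ! j) (vs ! k)" and V: "set vs = V"
    unfolding clockwise_listing_def by auto
  from z V obtain l where l: "l < length vs" "z = vs ! l" by (metis DiffD1 in_set_conv_nth)
  with z have ne: "l \<noteq> i" "l \<noteq> Suc i mod length vs" by auto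
  show "clockwise_triple (vs ! i) (vs ! (Suc i mod length vs)) z"
  proof (cases "Suc i < length vs")
    case True
    then have [simp]: "Suc i mod length vs = Suc i" by simp
    show ?thesis
    proof (cases "l < i")
      case True
      then have "clockwise_triple (vs ! l) (vs ! i) (vs ! Suc i)"
        using tr \<open>Suc i < length vs\<close> by simp
      then show ?thesis using clockwise_triple_rotate l by simp
    next
      case False
      then have "Suc i < l" using ne by simp
      then show ?thesis using tr[of i "Suc i" l] l by simp
    qed
  next
    case False
    then have s: "Suc i = length vs" using i by simp
    then have [simp]: "Suc i mod length vs = 0" by simp
    have "clockwise_triple (vs ! 0) (vs ! l) (vs ! i)"
      using tr[of 0 l i] ne l i s by simp
    then show ?thesis using clockwise_triple_rotate l by simp
  qed
qed

lemma clockwise_succ_iff: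
  assumes L: "clockwise_listing V vs" and ij: "i < length vs" "j < length vs" "i \<noteq> j"
  shows "clockwise_succ V (vs ! i) (vs ! j) \<longleftrightarrow> j = Suc i mod length vs"
proof
  assume S: "clockwise_succ V (vs ! i) (vs ! j)"
  show "j = Suc i mod length vs"
  proof (rule ccontr)
    assume ne: "j \<noteq> Suc i mod length vs"
    let ?l = "Suc i mod length vs"
    have D: "distinct vs" and V: "set vs = V" using L unfolding clockwise_listing_def by auto
    have l: "?l < length vs" by (rule mod_less_divisor) (use ij in linarith)
    have li: "?l \<noteq> i"
      using ij by (cases "Suc i < length vs") (auto simp: not_less le_Suc_eq mod_if)
    \<comment> \<open>Both \<open>j\<close> and the true successor would come first in the angular
      order around \<open>i\<close>, which antisymmetry forbids.\<close>
    have "clockwise_triple (vs ! i) (vs ! ?l) (vs ! j)"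
      using clockwise_listing_succ[OF L ij(1)] ij ne D V l nth_eq_iff_index_eq[OF D]
      unfolding clockwise_succ_def by auto
    moreover have "clockwise_triple (vs ! i) (vs ! j) (vs ! ?l)"
      using S ij ne D V l li nth_eq_iff_index_eq[OF D] unfolding clockwise_succ_def by auto
    ultimately show False using clockwise_triple_antisym by blast
  qed
next
  assume "j = Suc i mod length vs"
  then show "clockwise_succ V (vs ! i) (vs ! j)"
    using clockwise_listing_succ[OF L ij(1)] ij by auto
qed

text \<open>The successor relation does not mention a listing, so all listings give the same pairs.\<close>

lemma extremal_pairs_listing:
  assumes L: "clockwise_listing V vs" and 2: "2 \<le> length vs"
  shows "extremal_pairs V = (\<lambda>i. {vs ! i, vs ! (Suc i mod length vs)}) ` {..<length vs}"
proof -
  have A: "extremal_pairs V \<subseteq> (\<lambda>i. {ws ! i, ws ! (Suc i mod length ws)}) ` {..<length ws}"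
    if ws: "clockwise_listing V ws" for ws
  proof
    fix e assume "e \<in> extremal_pairs V"
    then obtain x y us i where e: "e = {x, y}" "x \<noteq> y" and us: "clockwise_listing V us"
      "i < length us" "x = us ! i" "y = us ! (Suc i mod length us)"
      unfolding extremal_pairs_def by auto
    have ml: "Suc i mod length us < length us" by (rule mod_less_divisor) (use us(2) in linarith)
    have "i \<noteq> Suc i mod length us" using e us by metis
    then have lu: "2 \<le> length us" using us(2) ml by linarith
    have S: "clockwise_succ V x y"
      using clockwise_listing_succ[OF us(1,2) lu] us by simp
    have V: "x \<in> set ws" "y \<in> set ws"
      using us(1) ws us(2-4) ml unfolding clockwise_listing_def by auto
    then obtain a b where ab: "a < length ws" "x = ws ! a" "b < length ws" "y = ws ! b"
      by (metis in_set_conv_nth)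
    then have "a \<noteq> b" using e by auto
    then have "b = Suc a mod length ws" using clockwise_succ_iff[OF ws ab(1,3)] S ab by auto
    then show "e \<in> (\<lambda>i. {ws ! i, ws ! (Suc i mod length ws)}) ` {..<length ws}"
      using ab e by auto
  qed
  moreover have "{vs ! i, vs ! (Suc i mod length vs)} \<in> extremal_pairs V" if i: "i < length vs" for i
  proof -
    have D: "distinct vs" using L unfolding clockwise_listing_def by auto
    have l: "Suc i mod length vs < length vs" by (rule mod_less_divisor) (use i in linarith)
    have "Suc i mod length vs \<noteq> i"
      using i 2 by (cases "Suc i < length vs") (auto simp: not_less le_Suc_eq mod_if)
    then have "vs ! i \<noteq> vs ! (Suc i mod length vs)" using nth_eq_iff_index_eq[OF D i l] by simp
    then show ?thesis unfolding extremal_pairs_def using L i by blast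
  qed
  ultimately show ?thesis using L by blast
qed

section \<open>Extremal paths and pair lengths\<close>

lemma extremal_path_map:
  assumes f: "bij_betw f V W"
    and E: "\<And>x y. x \<in> V \<Longrightarrow> y \<in> V \<Longrightarrow>
       {x, y} \<in> extremal_pairs V \<Longrightarrow> {f x, f y} \<in> extremal_pairs W"
    and p: "extremal_path V x y p"
  shows "extremal_path W (f x) (f y) (map f p)"
proof -
  have p': "p \<noteq> []" "hd p = x" "last p = y" "set p \<subseteq> V" "distinct p"
    "\<And>i. Suc i < length p \<Longrightarrow> {p ! i, p ! Suc i} \<in> extremal_pairs V"
    using p unfolding extremal_path_def by auto
  have "inj_on f (set p)" using f p' by (meson bij_betw_def inj_on_subset)
  moreover have "f ` set p \<subseteq> W" using f p' by (auto simp: bij_betw_def)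
  moreover have "{f (p ! i), f (p ! Suc i)} \<in> extremal_pairs W" if "Suc i < length p" for i
    using that p' E by (meson Suc_lessD in_mono nth_mem)
  ultimately show ?thesis
    unfolding extremal_path_def using p' by (simp add: hd_map last_map distinct_map)
qed

text \<open>Lengths depend on nothing but the cycle of extremal pairs, so paths can be carried over
  by \<open>f\<close> and by its inverse. This reduces the length condition of a convex isomorphism
  to hull edges.\<close>

lemma pair_length_map:
  assumes f: "bij_betw f V W"
    and E: "\<And>x y. x \<in> V \<Longrightarrow> y \<in> V \<Longrightarrow>
       {x, y} \<in> extremal_pairs V \<longleftrightarrow> {f x, f y} \<in> extremal_pairs W"
    and xy: "x \<in> V" "y \<in> V"
  shows "pair_length V x y = pair_length W (f x) (f y)"
proof -
  let ?g = "inv_into V f"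
  have g: "bij_betw ?g W V" using f by (rule bij_betw_inv_into)
  have fg: "\<And>w. w \<in> W \<Longrightarrow> f (?g w) = w" "\<And>v. v \<in> V \<Longrightarrow> ?g (f v) = v"
    "\<And>w. w \<in> W \<Longrightarrow> ?g w \<in> V"
    using f g by (auto simp: bij_betw_inv_into_right bij_betw_inv_into_left bij_betwE)
  have E': "{?g a, ?g b} \<in> extremal_pairs V"
    if "a \<in> W" "b \<in> W" "{a, b} \<in> extremal_pairs W" for a b
    using E[of "?g a" "?g b"] that fg by simp
  have "(\<exists>p. extremal_path V x y p \<and> l = length p - 1) \<longleftrightarrow>
        (\<exists>p. extremal_path W (f x) (f y) p \<and> l = length p - 1)" for l
  proof
    assume "\<exists>p. extremal_path V x y p \<and> l = length p - 1"
    then show "\<exists>p. extremal_path W (f x) (f y) p \<and> l = length p - 1"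
      using extremal_path_map[OF f] E by (metis length_map)
  next
    assume "\<exists>p. extremal_path W (f x) (f y) p \<and> l = length p - 1"
    then obtain p where p: "extremal_path W (f x) (f y) p" "l = length p - 1" by blast
    from extremal_path_map[OF g E' p(1)] have "extremal_path V x y (map ?g p)"
      using fg xy by simp
    then show "\<exists>p. extremal_path V x y p \<and> l = length p - 1" using p by (metis length_map)
  qed
  then show ?thesis unfolding pair_length_def by simp
qed

text \<open>Needed because \<open>LEAST\<close> is unspecified when no path exists. A stretch of the
  listing serves, reversed if \<open>y\<close> is listed before \<open>x\<close>.\<close>

lemma extremal_path_exists:
  assumes L: "clockwise_listing V vs" and xy: "x \<in> V" "y \<in> V" "x \<noteq> y"
  shows "\<exists>p. extremal_path V x y p"
proof -
  have D: "distinct vs" and V: "set vs = V" using L unfolding clockwise_listing_def by auto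
  obtain i j where ij: "i < length vs" "x = vs ! i" "j < length vs" "y = vs ! j"
    using xy V by (metis in_set_conv_nth)
  have "i \<noteq> j" using ij xy by auto
  then have len: "2 \<le> length vs" using ij by linarith
  have path: "extremal_path V (vs ! a) (vs ! b) (map ((!) vs) [a..<Suc b])"
    if ab: "a \<le> b" "b < length vs" for a b
  proof -
    have "distinct (map ((!) vs) [a..<Suc b])"
      using D ab by (auto simp: distinct_map inj_on_def nth_eq_iff_index_eq)
    moreover have "{vs ! (a + t), vs ! Suc (a + t)} \<in> extremal_pairs V" if "Suc (a + t) \<le> b" for t
      using that ab by (auto simp: extremal_pairs_listing[OF L len] intro!: image_eqI[of _ _ "a + t"])
    ultimately show ?thesis
      using ab V unfolding extremal_path_def
      by (auto simp: hd_map last_map hd_append simp del: upt_Suc)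
  qed
  have rev: "extremal_path V b a (rev p)" if "extremal_path V a b p" for a b p
  proof -
    have p': "p \<noteq> []" "hd p = a" "last p = b" "set p \<subseteq> V" "distinct p"
      "\<And>i. Suc i < length p \<Longrightarrow> {p ! i, p ! Suc i} \<in> extremal_pairs V"
      using that unfolding extremal_path_def by auto
    have "{rev p ! i, rev p ! Suc i} \<in> extremal_pairs V" if i: "Suc i < length p" for i
    proof -
      let ?j = "length p - Suc (Suc i)"
      have "{p ! ?j, p ! Suc ?j} \<in> extremal_pairs V" using p'(6)[of ?j] i by simp
      moreover have "Suc ?j = length p - Suc i" using i by simp
      ultimately show ?thesis using i by (simp add: rev_nth insert_commute)
    qed
    then show ?thesis using p' unfolding extremal_path_def by (simp add: hd_rev last_rev)
  qed
  show ?thesis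
  proof (cases "i \<le> j")
    case True then show ?thesis using path ij by blast
  next
    case False then show ?thesis using path[of j i] rev ij by fastforce
  qed
qed

text \<open>The only fact about lengths that the obstruction uses: a map preserving lengths
  preserves hull edges.\<close>

lemma pair_length_eq_1_iff:
  assumes L: "clockwise_listing V vs" and xy: "x \<in> V" "y \<in> V" "x \<noteq> y"
  shows "pair_length V x y = 1 \<longleftrightarrow> {x, y} \<in> extremal_pairs V"
proof
  let ?P = "\<lambda>l. \<exists>p. extremal_path V x y p \<and> l = length p - 1"
  have ex: "\<exists>l. ?P l" using extremal_path_exists[OF L xy] by blast
  assume "pair_length V x y = 1"
  then have "?P 1" unfolding pair_length_def using LeastI_ex[OF ex] by simp
  then obtain p where p: "extremal_path V x y p" "length p - 1 = 1" by auto
  then have "length p = 2" by simp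
  then obtain a b where "p = [a, b]"
    by (metis (no_types, lifting) One_nat_def Suc_1 length_0_conv length_Suc_conv)
  then show "{x, y} \<in> extremal_pairs V" using p unfolding extremal_path_def by auto
next
  let ?P = "\<lambda>l. \<exists>p. extremal_path V x y p \<and> l = length p - 1"
  assume "{x, y} \<in> extremal_pairs V"
  then have "extremal_path V x y [x, y]" using xy unfolding extremal_path_def by auto
  then have 1: "?P 1" by (intro exI[of _ "[x, y]"]) auto
  have 0: "\<not> ?P 0"
  proof
    assume "?P 0"
    then obtain p where p: "extremal_path V x y p" "length p - 1 = 0" by auto
    then have "length p = 1" unfolding extremal_path_def by (cases p) auto
    then obtain a where "p = [a]" by (cases p) auto
    then show False using p xy unfolding extremal_path_def by auto
  qed
  show "pair_length V x y = 1"
    unfolding pair_length_def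
  proof (rule Least_equality)
    show "?P 1" by (rule 1)
    show "1 \<le> l" if "?P l" for l using that 0 by (cases l) auto
  qed
qed

section \<open>Points in strictly convex position\<close>

text \<open>Twice the signed area of the triangle \<open>a b c\<close>.\<close>

definition orient :: "complex \<Rightarrow> complex \<Rightarrow> complex \<Rightarrow> real" where
  "orient a b c = (Re b - Re a) * (Im c - Im a) - (Im b - Im a) * (Re c - Re a)"

lemma clockwise_triple_orient: "clockwise_triple a b c \<longleftrightarrow> orient a b c < 0"
  unfolding clockwise_triple_alt orient_def ..

text \<open>The barycentric coordinates of \<open>d\<close> are the ratios of the areas of the three
  subtriangles to that of \<open>a b c\<close>. The last hypothesis is weak because it arises as the
  negation of a clockwise turn.\<close>

lemma in_triangle:
  assumes "orient a b d < 0" "orient a d c < 0" "orient a b c < 0" "0 \<le> orient b d c"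
  shows "d \<in> convex hull {a, b, c}"
proof -
  let ?D = "orient a b c"
  let ?u = "orient b c d / ?D" and ?v = "orient a d c / ?D" and ?w = "orient a b d / ?D"
  have D0: "?D \<noteq> 0" using assms by simp
  have "orient b c d = - orient b d c" unfolding orient_def by (simp add: algebra_simps)
  then have pos: "0 \<le> ?u" "0 \<le> ?v" "0 \<le> ?w" using assms by (auto simp: divide_nonpos_neg divide_nonneg_neg)
  have sum: "orient b c d + orient a d c + orient a b d = ?D"
    unfolding orient_def by (simp add: algebra_simps)
  then have sum1: "?u + ?v + ?w = 1" using D0 by (simp add: add_divide_distrib[symmetric])
  have R: "orient b c d * Re a + orient a d c * Re b + orient a b d * Re c = ?D * Re d"
    and I: "orient b c d * Im a + orient a d c * Im b + orient a b d * Im c = ?D * Im d"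
    unfolding orient_def by (simp_all add: algebra_simps)
  have "d = ?u *\<^sub>R a + ?v *\<^sub>R b + ?w *\<^sub>R c"
  proof (rule complex_eqI)
    show "Re d = Re (?u *\<^sub>R a + ?v *\<^sub>R b + ?w *\<^sub>R c)"
      using R D0 by (simp add: add_divide_distrib[symmetric])
    show "Im d = Im (?u *\<^sub>R a + ?v *\<^sub>R b + ?w *\<^sub>R c)"
      using I D0 by (simp add: add_divide_distrib[symmetric])
  qed
  then show ?thesis unfolding convex_hull_3 using pos sum1 by blast
qed

lemma strictly_convex_positionD:
  assumes "strictly_convex_position V" "x \<in> V" "A \<subseteq> V" "x \<in> convex hull A"
  shows "x \<in> A"
proof (rule ccontr)
  assume "x \<notin> A"
  then have "convex hull A \<subseteq> convex hull (V - {x})" using assms by (intro hull_mono) auto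
  then show False using assms unfolding strictly_convex_position_def by blast
qed

text \<open>Seen from a vertex \<open>v\<close>, the other vertices lie in an open half-plane, so sorting them by slope
  lists them by angle.\<close>

lemma clockwise_listing_exists:
  assumes fin: "finite V" and scp: "strictly_convex_position V"
  shows "\<exists>vs. clockwise_listing V vs"
proof (cases "V = {}")
  case True
  then show ?thesis by (intro exI[of _ "[]"]) (simp add: clockwise_listing_def)
next
  case False
  then obtain v where v: "v \<in> V" by blast
  let ?W = "V - {v}"
  have "v \<notin> convex hull ?W" using scp v unfolding strictly_convex_position_def by blast
  moreover have "closed (convex hull ?W)"
    using fin by (intro compact_imp_closed finite_imp_compact_convex_hull) auto
  ultimately obtain a b where ab: "a \<bullet> v < b" "\<And>x. x \<in> convex hull ?W \<Longrightarrow> b < a \<bullet> x"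
    using separating_hyperplane_closed_point[of "convex hull ?W" v] by auto
  \<comment> \<open>Up to the factor \<open>norm a\<close>, \<open>h\<close> and \<open>g\<close>
    are the coordinates of \<open>x - v\<close> along \<open>a\<close> and perpendicular to it. As
    \<open>h\<close> is positive away from \<open>v\<close>, \<open>key\<close> is the negated
    slope, and increasing \<open>key\<close> means turning clockwise.\<close>
  define h where "h = (\<lambda>x. a \<bullet> (x - v))"
  define g where "g = (\<lambda>x. Im (cnj a * (x - v)))"
  define key where "key = (\<lambda>x. - (g x / h x))"
  have hpos: "0 < h x" if "x \<in> ?W" for x
  proof -
    have "b < a \<bullet> x" by (rule ab(2), rule hull_inc, rule that)
    then show ?thesis using ab(1) unfolding h_def by (simp add: inner_diff_right)
  qed
  have hg: "(Re a ^ 2 + Im a ^ 2) * orient v x y = h x * g y - g x * h y" for x y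
    unfolding h_def g_def orient_def inner_complex_def
    by (simp add: algebra_simps power2_eq_square)
  have keyless: "orient v x y < 0" if "x \<in> ?W" "y \<in> ?W" "key x < key y" for x y
  proof -
    have "g y / h y < g x / h x" using that unfolding key_def by simp
    then have "g y * h x < g x * h y" using hpos that by (simp add: field_simps)
    then have "(Re a ^ 2 + Im a ^ 2) * orient v x y < 0" unfolding hg by (simp add: mult.commute)
    then show ?thesis
      by (rule contrapos_pp) (simp add: not_less)
  qed
  \<comment> \<open>Points of equal slope lie on one ray from \<open>v\<close>, so the nearer one
    would belong to the segment from \<open>v\<close> to the farther one.\<close>
  have aux: "x = y" if xy: "x \<in> ?W" "y \<in> ?W" "key x = key y" "h x \<le> h y" for x y
  proof -
    let ?l = "h x / h y"
    have l: "0 \<le> ?l" "?l \<le> 1" using hpos xy by (auto simp: less_imp_le)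
    have a0: "Re a ^ 2 + Im a ^ 2 \<noteq> 0"
      using hpos[OF xy(1)] unfolding h_def inner_complex_def by (auto simp: sum_power2_eq_zero_iff)
    have gg: "h x * g y = g x * h y" using xy hpos unfolding key_def by (force simp: field_simps)
    have R: "(Re a ^ 2 + Im a ^ 2) * Re (x - v) = Re a * h x - Im a * g x"
      "(Re a ^ 2 + Im a ^ 2) * Im (x - v) = Im a * h x + Re a * g x" for x
      unfolding h_def g_def inner_complex_def by (simp_all add: algebra_simps power2_eq_square)
    have "h y *\<^sub>R (x - v) = h x *\<^sub>R (y - v)"
    proof (rule complex_eqI)
      have "(Re a ^ 2 + Im a ^ 2) * (h y * Re (x - v)) = h y * ((Re a ^ 2 + Im a ^ 2) * Re (x - v))"
        by (simp only: mult.left_commute)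
      also have "\<dots> = h y * (Re a * h x - Im a * g x)" by (simp only: R)
      also have "\<dots> = h x * (Re a * h y - Im a * g y)" using gg by algebra
      also have "\<dots> = h x * ((Re a ^ 2 + Im a ^ 2) * Re (y - v))" by (simp only: R)
      also have "\<dots> = (Re a ^ 2 + Im a ^ 2) * (h x * Re (y - v))" by (simp only: mult.left_commute)
      finally have "(Re a ^ 2 + Im a ^ 2) * (h y * Re (x - v)) = (Re a ^ 2 + Im a ^ 2) * (h x * Re (y - v))" .
      then show "Re (h y *\<^sub>R (x - v)) = Re (h x *\<^sub>R (y - v))" using a0 by force
      have "(Re a ^ 2 + Im a ^ 2) * (h y * Im (x - v)) = h y * ((Re a ^ 2 + Im a ^ 2) * Im (x - v))"
        by (simp only: mult.left_commute)
      also have "\<dots> = h y * (Im a * h x + Re a * g x)" by (simp only: R)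
      also have "\<dots> = h x * (Im a * h y + Re a * g y)" using gg by algebra
      also have "\<dots> = h x * ((Re a ^ 2 + Im a ^ 2) * Im (y - v))" by (simp only: R)
      also have "\<dots> = (Re a ^ 2 + Im a ^ 2) * (h x * Im (y - v))" by (simp only: mult.left_commute)
      finally have "(Re a ^ 2 + Im a ^ 2) * (h y * Im (x - v)) = (Re a ^ 2 + Im a ^ 2) * (h x * Im (y - v))" .
      then show "Im (h y *\<^sub>R (x - v)) = Im (h x *\<^sub>R (y - v))" using a0 by force
    qed
    then have "h y *\<^sub>R (x - v) = h y *\<^sub>R (?l *\<^sub>R (y - v))" using hpos[OF xy(2)] by simp
    then have "x - v = ?l *\<^sub>R (y - v)" using hpos[OF xy(2)]
      by (metis less_irrefl scaleR_cancel_left)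
    then have "x = (1 - ?l) *\<^sub>R v + ?l *\<^sub>R y"
      by (simp add: algebra_simps)
    then have "x \<in> convex hull {v, y}"
      unfolding segment_convex_hull[symmetric] in_segment using l by blast
    then have "x \<in> {v, y}" by (intro strictly_convex_positionD[OF scp, of x "{v, y}"]) (use xy v in auto)
    then show ?thesis using xy by blast
  qed
  have inj: "x = y" if "x \<in> ?W" "y \<in> ?W" "key x = key y" for x y
  proof (cases "h x \<le> h y")
    case True with aux that show ?thesis by metis
  next
    case False
    then have "h y \<le> h x" by linarith
    then show ?thesis using aux[OF that(2,1) that(3)[symmetric]] by simp
  qed
  obtain ws0 where ws0: "set ws0 = ?W" "distinct ws0" using finite_distinct_list[of ?W] fin by auto
  define ws where "ws = sort_key key ws0"
  have ws: "set ws = ?W" "distinct ws" "sorted (map key ws)" using ws0 by (auto simp: ws_def)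
  have ord: "orient v (ws ! i) (ws ! j) < 0" if "i < j" "j < length ws" for i j
  proof -
    have m: "ws ! i \<in> ?W" "ws ! j \<in> ?W" using ws that by (metis less_trans nth_mem)+
    have "key (ws ! i) \<le> key (ws ! j)"
      using sorted_nth_mono[OF ws(3), of i j] that by simp
    moreover have "ws ! i \<noteq> ws ! j" using ws that by (simp add: nth_eq_iff_index_eq)
    ultimately have "key (ws ! i) < key (ws ! j)" using inj[OF m] by linarith
    then show ?thesis by (rule keyless[OF m])
  qed
  \<comment> \<open>A turn that is not clockwise would put the middle point into the triangle
    spanned by \<open>v\<close> and the other two.\<close>
  have tri: "orient (ws ! i) (ws ! j) (ws ! k) < 0" if "i < j" "j < k" "k < length ws" for i j k
  proof (rule ccontr)
    assume "\<not> ?thesis"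
    then have "ws ! j \<in> convex hull {v, ws ! i, ws ! k}"
      using ord that by (intro in_triangle) auto
    moreover have m: "ws ! i \<in> ?W" "ws ! j \<in> ?W" "ws ! k \<in> ?W"
      using ws that by (metis less_trans nth_mem)+
    ultimately have "ws ! j \<in> {v, ws ! i, ws ! k}"
      by (intro strictly_convex_positionD[OF scp, of "ws ! j" "{v, ws ! i, ws ! k}"]) (use v in auto)
    then show False using m ws that by (auto simp: nth_eq_iff_index_eq)
  qed
  have "clockwise_triple ((v # ws) ! i) ((v # ws) ! j) ((v # ws) ! k)"
    if "i < j" "j < k" "k < length (v # ws)" for i j k
    using that tri ord by (cases i; cases j; cases k) (auto simp: clockwise_triple_orient)
  then have "clockwise_listing V (v # ws)"
    unfolding clockwise_listing_def using ws v by auto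
  then show ?thesis ..
qed

text \<open>The line \<open>a c\<close> divides \<open>b d\<close> in the ratio of the areas of
  \<open>a b c\<close> and \<open>a c d\<close>, and likewise with the diagonals exchanged. Both
  area sums equal \<open>?Q\<close>, the doubled signed area of the quadrilateral.\<close>

lemma diagonals_cross:
  assumes "orient a b c < 0" "orient a b d < 0" "orient a c d < 0" "orient b c d < 0"
  shows "open_segment a c \<inter> open_segment b d \<noteq> {}"
proof -
  let ?Q = "orient a b c + orient a c d"
  let ?s = "orient a b c / ?Q" and ?t = "orient a b d / ?Q"
  have Q: "?Q < 0" using assms by simp
  have Q2: "?Q = orient a b d + orient b c d" unfolding orient_def by (simp add: algebra_simps)
  have s: "0 < ?s" "?s < 1" using Q assms by (auto simp: divide_neg_neg divide_less_eq)
  have t: "0 < ?t" "?t < 1" using Q Q2 assms by (auto simp: divide_neg_neg divide_less_eq)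
  let ?p = "(1 - ?t) *\<^sub>R a + ?t *\<^sub>R c"
  have R: "(?Q - orient a b d) * Re a + orient a b d * Re c = (?Q - orient a b c) * Re b + orient a b c * Re d"
    and I: "(?Q - orient a b d) * Im a + orient a b d * Im c = (?Q - orient a b c) * Im b + orient a b c * Im d"
    unfolding orient_def by (simp_all add: algebra_simps)
  have 1: "1 - x / ?Q = (?Q - x) / ?Q" for x using Q by (simp add: diff_divide_distrib)
  have eq: "?p = (1 - ?s) *\<^sub>R b + ?s *\<^sub>R d"
  proof (rule complex_eqI)
    show "Re ?p = Re ((1 - ?s) *\<^sub>R b + ?s *\<^sub>R d)"
      unfolding 1 using R by (simp add: add_divide_distrib[symmetric])
    show "Im ?p = Im ((1 - ?s) *\<^sub>R b + ?s *\<^sub>R d)"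
      unfolding 1 using I by (simp add: add_divide_distrib[symmetric])
  qed
  have "a \<noteq> c" "b \<noteq> d" using assms unfolding orient_def by auto
  then have "?p \<in> open_segment a c" "?p \<in> open_segment b d"
    using s t eq unfolding in_segment by blast+
  then show ?thesis by blast
qed

lemma clockwise_listing_cross:
  assumes L: "clockwise_listing V vs" and "i < j" "j < k" "k < l" "l < length vs"
  shows "open_segment (vs ! i) (vs ! k) \<inter> open_segment (vs ! j) (vs ! l) \<noteq> {}"
  using assms unfolding clockwise_listing_def
  by (intro diagonals_cross) (auto simp: clockwise_triple_orient[symmetric])

text \<open>The doubled signed area of an inscribed triangle is
  \<open>- 4 * sin p * sin q * sin (p + q)\<close> with half the arcs as angles, and
  \<open>p\<close>, \<open>q\<close>, \<open>p + q\<close> lie strictly between 0 and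
  \<open>pi\<close>.\<close>

lemma clockwise_triple_cis:
  assumes "a < b" "b < c" "c < a + 2 * pi"
  shows "clockwise_triple (cis (- a)) (cis (- b)) (cis (- c))"
proof -
  define p q where "p = (b - a) / 2" and "q = (c - b) / 2"
  have "sin (2 * p) + sin (2 * q) - sin (2 * p + 2 * q) = 4 * sin p * sin q * sin (p + q)"
    unfolding sin_add sin_double cos_double_sin by (simp add: algebra_simps power2_eq_square)
  moreover have "0 < 4 * sin p * sin q * sin (p + q)"
    using assms unfolding p_def q_def
    by (intro mult_pos_pos sin_gt_zero) (auto simp: field_simps)
  moreover have "orient (cis (- a)) (cis (- b)) (cis (- c)) = - (sin (b - a) + sin (c - b) - sin (c - a))"
    unfolding orient_def sin_diff by (simp add: algebra_simps)
  moreover have "2 * p + 2 * q = c - a" "2 * p = b - a" "2 * q = c - b"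
    unfolding p_def q_def by (auto simp: field_simps)
  ultimately show ?thesis unfolding clockwise_triple_orient by simp
qed

lemma clockwise_triple_polygon:
  assumes "1 \<le> i" "i < j" "j < k" "k \<le> n"
  shows "clockwise_triple (polygon_vertex n i) (polygon_vertex n j) (polygon_vertex n k)"
  unfolding polygon_vertex_def
proof (rule clockwise_triple_cis)
  have n: "0 < real n" using assms by simp
  show "2 * pi * real i / real n < 2 * pi * real j / real n"
    "2 * pi * real j / real n < 2 * pi * real k / real n"
    using assms n by (auto intro!: divide_strict_right_mono)
  have "real k < real i + real n" using assms by simp
  then have "2 * pi * real k < 2 * pi * (real i + real n)" by simp
  then show "2 * pi * real k / real n < 2 * pi * real i / real n + 2 * pi"
    using n by (simp add: field_simps)
qed

lemma inj_on_polygon_vertex: "inj_on (polygon_vertex n) {1..n}"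
proof (rule linorder_inj_onI')
  fix i j assume ij: "i \<in> {1..n}" "j \<in> {1..n}" "i < j"
  show "polygon_vertex n i \<noteq> polygon_vertex n j"
  proof
    assume eq: "polygon_vertex n i = polygon_vertex n j"
    have n: "0 < real n" using ij by simp
    let ?d = "2 * pi * (real j - real i) / real n"
    have "cis (- (2 * pi * real i / real n)) = cis (- (2 * pi * real j / real n)) * cis ?d"
      unfolding cis_mult by (simp add: diff_divide_distrib right_diff_distrib)
    then have "cis ?d = 1" using eq unfolding polygon_vertex_def by simp
    then have "cos ?d = 1" by (metis cis.sel(1) one_complex.sel(1))
    then obtain m :: int where "?d = of_int m * 2 * pi" using cos_one_2pi_int by blast
    then have "2 * pi * (real j - real i) = 2 * pi * (of_int m * real n)" using n by (simp add: field_simps)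
    then have m: "real j - real i = of_int m * real n" unfolding mult_cancel_left by simp
    then have "int j - int i = m * int n"
      by (metis of_int_diff of_int_eq_iff of_int_mult of_int_of_nat_eq)
    moreover have "0 < int j - int i" "int j - int i < int n" using ij by auto
    ultimately have "0 < m * int n" "m * int n < 1 * int n" by simp_all
    then have "0 < m" "m < 1" by (simp_all add: zero_less_mult_iff mult_less_cancel_right)
    then show False by simp
  qed
qed

text \<open>The tangent at \<open>x\<close> separates: by the equality case of Cauchy-Schwarz, all
  other points of the circle lie in the open half-plane of \<open>y\<close> with inner product
  \<open>x\<close> and \<open>y\<close> below 1.\<close>

lemma convex_position_circle:
  assumes "V \<subseteq> sphere 0 1"
  shows "strictly_convex_position V"
  unfolding strictly_convex_position_def
proof
  fix x assume x: "x \<in> V"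
  have "V - {x} \<subseteq> {y. x \<bullet> y < 1}"
  proof
    fix y assume y: "y \<in> V - {x}"
    have n: "norm x = 1" "norm y = 1" using x y assms by auto
    have "x \<bullet> y \<noteq> norm x * norm y" using n y unfolding norm_cauchy_schwarz_eq by auto
    moreover have "x \<bullet> y \<le> norm x * norm y" by (rule norm_cauchy_schwarz)
    ultimately show "y \<in> {y. x \<bullet> y < 1}" using n by simp
  qed
  then have "convex hull (V - {x}) \<subseteq> {y. x \<bullet> y < 1}"
    by (rule hull_minimal) (rule convex_halfspace_lt)
  moreover have "x \<bullet> x = 1" using x assms by (auto simp: norm_eq_1[symmetric])
  ultimately show "x \<notin> convex hull (V - {x})" by auto
qed

lemma regular_polygon_sphere: "regular_polygon n \<subseteq> sphere 0 1"
  unfolding regular_polygon_def polygon_vertex_def by auto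

section \<open>Graphs on listed vertices and their packings\<close>

text \<open>Edges are sets of positions in a clockwise listing, so that hull, crossings and
  symmetries become statements about natural numbers.\<close>

definition listed_cgg :: "complex list \<Rightarrow> nat set set \<Rightarrow> cgg" where
  "listed_cgg vs E = \<lparr>verts = set vs, edges = (`) ((!) vs) ` E\<rparr>"

definition hull_pairs :: "nat \<Rightarrow> nat set set" where
  "hull_pairs k = (\<lambda>i. {i, Suc i mod k}) ` {..<k}"

lemma hull_pairs_subset: "e \<in> hull_pairs k \<Longrightarrow> e \<subseteq> {..<k}"
  unfolding hull_pairs_def by auto

lemma hull_pairs_Suc: "hull_pairs (Suc m) = insert {m, 0} ((\<lambda>i. {i, Suc i}) ` {..<m})"
proof -
  have "(\<lambda>i. {i, Suc i mod Suc m}) ` {..<m} = (\<lambda>i. {i, Suc i}) ` {..<m}"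
    by (rule image_cong) auto
  then show ?thesis unfolding hull_pairs_def lessThan_Suc by simp
qed

lemma image_mem_image_iff:
  assumes "inj_on g A" "e \<subseteq> A" "\<And>e. e \<in> S \<Longrightarrow> e \<subseteq> A"
  shows "g ` e \<in> (`) g ` S \<longleftrightarrow> e \<in> S"
  using assms by (auto simp: inj_on_image_eq_iff)

lemma inj_on_nth_lessThan: "distinct vs \<Longrightarrow> length vs = k \<Longrightarrow> inj_on ((!) vs) {..<k}"
  by (auto simp: inj_on_def nth_eq_iff_index_eq)

lemma extremal_pairs_listed:
  assumes "clockwise_listing (set vs) vs" "2 \<le> length vs"
  shows "extremal_pairs (set vs) = (`) ((!) vs) ` hull_pairs (length vs)"
  unfolding extremal_pairs_listing[OF assms] hull_pairs_def image_image by simp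

lemma convex_isomorphic_listed:
  assumes V: "clockwise_listing (set vs) vs" "length vs = k"
    and W: "clockwise_listing (set ws) ws" "length ws = k"
    and k: "2 \<le> k"
    and E: "\<And>e. e \<in> E \<Longrightarrow> e \<subseteq> {..<k}"
    and s: "bij_betw s {..<k} {..<k}" and sh: "(`) s ` hull_pairs k = hull_pairs k"
  shows "convex_isomorphic (listed_cgg vs E) (listed_cgg ws ((`) s ` E))"
proof -
  have dv: "distinct vs" and dw: "distinct ws" using V W unfolding clockwise_listing_def by auto
  have iv: "inj_on ((!) vs) {..<k}" and iw: "inj_on ((!) ws) {..<k}"
    using dv dw V W by (auto intro: inj_on_nth_lessThan)
  have bv: "bij_betw ((!) vs) {..<k} (set vs)" and bw: "bij_betw ((!) ws) {..<k} (set ws)"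
    using iv iw V W by (auto simp: bij_betw_def set_conv_nth)
  define f where "f = (!) ws \<circ> s \<circ> inv_into {..<k} ((!) vs)"
  have fb: "bij_betw f (set vs) (set ws)"
    unfolding f_def by (intro bij_betw_trans[OF bij_betw_inv_into[OF bv]] bij_betw_trans[OF s] bw)
  have fv: "f (vs ! a) = ws ! (s a)" if "a < k" for a
    unfolding f_def using that iv by simp
  have sk: "s a < k" if "a < k" for a using s that by (auto dest: bij_betwE)
  have si: "inj_on s {..<k}" using s by (simp add: bij_betw_def)
  have mem: "{vs ! a, vs ! b} \<in> (`) ((!) vs) ` S \<longleftrightarrow> {f (vs ! a), f (vs ! b)} \<in> (`) ((!) ws) ` ((`) s ` S)"
    if S: "\<And>e. e \<in> S \<Longrightarrow> e \<subseteq> {..<k}" and ab: "a < k" "b < k" for S a b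
  proof -
    have "{vs ! a, vs ! b} \<in> (`) ((!) vs) ` S \<longleftrightarrow> {a, b} \<in> S"
      using image_mem_image_iff[OF iv _ S, of "{a, b}"] ab by simp
    also have "\<dots> \<longleftrightarrow> {s a, s b} \<in> (`) s ` S"
      using image_mem_image_iff[OF si _ S, of "{a, b}"] ab by simp
    also have "\<dots> \<longleftrightarrow> {ws ! s a, ws ! s b} \<in> (`) ((!) ws) ` ((`) s ` S)"
    proof -
      have "\<And>e. e \<in> (`) s ` S \<Longrightarrow> e \<subseteq> {..<k}" using S sk by fastforce
      from image_mem_image_iff[OF iw _ this, of "{s a, s b}"] show ?thesis using ab sk by simp
    qed
    finally show ?thesis using fv ab by simp
  qed
  have idx: "\<exists>a<k. x = vs ! a" if "x \<in> set vs" for x using that V by (metis in_set_conv_nth)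
  have ext: "{x, y} \<in> extremal_pairs (set vs) \<longleftrightarrow> {f x, f y} \<in> extremal_pairs (set ws)"
    if xy: "x \<in> set vs" "y \<in> set vs" for x y
  proof -
    obtain a b where ab: "a < k" "x = vs ! a" "b < k" "y = vs ! b" using idx xy by metis
    show ?thesis
      using mem[OF hull_pairs_subset ab(1,3)] V W k ab
      by (simp add: extremal_pairs_listed sh)
  qed
  show ?thesis
    unfolding convex_isomorphic_def
  proof (intro exI conjI ballI)
    show "bij_betw f (verts (listed_cgg vs E)) (verts (listed_cgg ws ((`) s ` E)))"
      using fb by (simp add: listed_cgg_def)
    fix x y assume xy: "x \<in> verts (listed_cgg vs E)" "y \<in> verts (listed_cgg vs E)"
    then have xy': "x \<in> set vs" "y \<in> set vs" by (auto simp: listed_cgg_def)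
    show "pair_length (verts (listed_cgg vs E)) x y =
          pair_length (verts (listed_cgg ws ((`) s ` E))) (f x) (f y)"
      using pair_length_map[OF fb ext xy'] by (simp add: listed_cgg_def)
    obtain a b where ab: "a < k" "x = vs ! a" "b < k" "y = vs ! b" using idx xy' by metis
    then show "({x, y} \<in> edges (listed_cgg vs E)) =
               ({f x, f y} \<in> edges (listed_cgg ws ((`) s ` E)))"
      using mem[OF E ab(1,3)] by (simp add: listed_cgg_def)
  qed
qed

text \<open>The definition compares pairs of vertices. Since edges have two elements, this yields a
  bijection of the edge sets, which is what counting needs.\<close>

lemma convex_isomorphic_edges:
  assumes iso: "convex_isomorphic H G"
    and H: "\<And>e. e \<in> edges H \<Longrightarrow> e \<subseteq> verts H \<and> card e = 2"
    and G: "\<And>e. e \<in> edges G \<Longrightarrow> e \<subseteq> verts G \<and> card e = 2"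
  obtains f where "bij_betw f (verts H) (verts G)" "bij_betw ((`) f) (edges H) (edges G)"
    "\<And>x y. x \<in> verts H \<Longrightarrow> y \<in> verts H \<Longrightarrow>
       pair_length (verts H) x y = pair_length (verts G) (f x) (f y)"
proof -
  from iso obtain f where f: "bij_betw f (verts H) (verts G)" and
    pl: "\<And>x y. x \<in> verts H \<Longrightarrow> y \<in> verts H \<Longrightarrow>
       pair_length (verts H) x y = pair_length (verts G) (f x) (f y)" and
    ed: "\<And>x y. x \<in> verts H \<Longrightarrow> y \<in> verts H \<Longrightarrow>
       {x, y} \<in> edges H \<longleftrightarrow> {f x, f y} \<in> edges G"
    unfolding convex_isomorphic_def by auto
  have fi: "inj_on f (verts H)" and fs: "f ` verts H = verts G"
    using f by (auto simp: bij_betw_def)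
  have "inj_on ((`) f) (edges H)"
    using H fi by (intro inj_onI) (metis inj_on_image_eq_iff)
  moreover have "(`) f ` edges H = edges G"
  proof (intro subset_antisym subsetI)
    fix e assume "e \<in> (`) f ` edges H"
    then obtain d where d: "d \<in> edges H" "e = f ` d" by blast
    obtain x y where "d = {x, y}" using H[OF d(1)] by (meson card_2_iff)
    then show "e \<in> edges G" using d ed[of x y] H[OF d(1)] by auto
  next
    fix e assume e: "e \<in> edges G"
    obtain a b where ab: "e = {a, b}" using G[OF e] by (meson card_2_iff)
    then have "a \<in> f ` verts H" "b \<in> f ` verts H" using G[OF e] fs by auto
    then obtain x y where xy: "x \<in> verts H" "y \<in> verts H" "a = f x" "b = f y" by blast
    then have "{x, y} \<in> edges H" using ed e ab by simp
    moreover have "e = f ` {x, y}" using ab xy by simp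
    ultimately show "e \<in> (`) f ` edges H" by blast
  qed
  ultimately show thesis using that f pl by (auto simp: bij_betw_def)
qed

section \<open>Finiteness of packings and the packing number\<close>

lemma card_regular_polygon: "card (regular_polygon n) = n"
  unfolding regular_polygon_def using card_image[OF inj_on_polygon_vertex, of n] by simp

lemma card_edges_complete: "card (edges (complete_cgg n)) = n choose 2"
proof -
  have "finite (regular_polygon n)" unfolding regular_polygon_def by simp
  from n_subsets[OF this, of 2] show ?thesis
    unfolding complete_cgg_def by (simp add: card_regular_polygon)
qed

lemma finite_edges_complete: "finite (edges (complete_cgg n))"
proof -
  have "finite (regular_polygon n)" unfolding regular_polygon_def by simp
  then show ?thesis unfolding complete_cgg_def by simp
qed

lemma edges_convex_geometric_graph:
  "convex_geometric_graph G \<Longrightarrow> e \<in> edges G \<Longrightarrow> e \<subseteq> verts G \<and> card e = 2"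
  unfolding convex_geometric_graph_def by blast

lemma packing_edges:
  assumes G: "convex_geometric_graph G" and P: "packing G n P"
  shows "\<And>H. H \<in> P \<Longrightarrow> edges H \<subseteq> edges (complete_cgg n)"
    and "\<And>H. H \<in> P \<Longrightarrow> card (edges H) = card (edges G)"
    and "\<And>H H'. H \<in> P \<Longrightarrow> H' \<in> P \<Longrightarrow> H \<noteq> H' \<Longrightarrow> edges H \<inter> edges H' = {}"
proof -
  show "edges H \<subseteq> edges (complete_cgg n)" if "H \<in> P" for H
    using P that unfolding packing_def subgraph_def by blast
  show "card (edges H) = card (edges G)" if "H \<in> P" for H
  proof -
    have H: "convex_geometric_graph H" "convex_isomorphic H G"
      using P that unfolding packing_def subgraph_def by auto
    obtain f where "bij_betw ((`) f) (edges H) (edges G)"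
      using convex_isomorphic_edges[OF H(2) edges_convex_geometric_graph[OF H(1)]
          edges_convex_geometric_graph[OF G]] by metis
    then show ?thesis by (rule bij_betw_same_card)
  qed
  show "edges H \<inter> edges H' = {}" if "H \<in> P" "H' \<in> P" "H \<noteq> H'" for H H'
    using P that unfolding packing_def by blast
qed

text \<open>Members have disjoint nonempty edge sets, so \<open>edges\<close> embeds
  \<open>P\<close> into a finite power set.\<close>

lemma finite_packing:
  assumes G: "convex_geometric_graph G" "0 < card (edges G)" and P: "packing G n P"
  shows "finite P"
proof -
  note E = packing_edges[OF G(1) P]
  have "inj_on edges P"
  proof (rule inj_onI, rule ccontr)
    fix H H' assume H: "H \<in> P" "H' \<in> P" "edges H = edges H'" "H \<noteq> H'"
    then have "edges H = {}" using E(3) by blast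
    then show False using E(2)[OF H(1)] G by simp
  qed
  moreover have "edges ` P \<subseteq> Pow (edges (complete_cgg n))" using E(1) by blast
  then have "finite (edges ` P)" using finite_edges_complete by (meson finite_Pow_iff finite_subset)
  ultimately show ?thesis using finite_imageD by blast
qed

lemma card_edges_packing:
  assumes G: "convex_geometric_graph G" "0 < card (edges G)" and P: "packing G n P"
  shows "card (\<Union>H\<in>P. edges H) = card P * card (edges G)"
proof -
  note E = packing_edges[OF G(1) P]
  have "finite (edges H)" if "H \<in> P" for H using E(1)[OF that] finite_edges_complete finite_subset by blast
  then have "card (\<Union>H\<in>P. edges H) = (\<Sum>H\<in>P. card (edges H))"
    using E finite_packing[OF G P] by (intro card_UN_disjoint) auto
  also have "\<dots> = (\<Sum>H\<in>P. card (edges G))" using E(2) by (intro sum.cong) auto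
  finally show ?thesis by simp
qed

lemma card_packing_le:
  assumes G: "convex_geometric_graph G" "0 < card (edges G)" and P: "packing G n P"
  shows "card P * card (edges G) \<le> n choose 2"
proof -
  have "(\<Union>H\<in>P. edges H) \<subseteq> edges (complete_cgg n)" using packing_edges[OF G(1) P] by blast
  from card_mono[OF finite_edges_complete this] show ?thesis
    unfolding card_edges_packing[OF G P] card_edges_complete .
qed

lemma finite_packing_sizes:
  assumes G: "convex_geometric_graph G" "0 < card (edges G)"
  shows "finite (card ` {P. packing G n P})"
proof (rule finite_subset)
  show "card ` {P. packing G n P} \<subseteq> {..n choose 2}"
  proof
    fix c assume "c \<in> card ` {P. packing G n P}"
    then obtain P where P: "packing G n P" "c = card P" by blast
    have "c \<le> c * card (edges G)" using G by (cases "card (edges G)") auto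
    also have "\<dots> \<le> n choose 2" using card_packing_le[OF G P(1)] P(2) by simp
    finally show "c \<in> {..n choose 2}" by simp
  qed
qed simp

lemma packing_number_ge:
  assumes G: "convex_geometric_graph G" "0 < card (edges G)" and P: "packing G n P"
  shows "card P \<le> packing_number n G"
  unfolding packing_number_def using P finite_packing_sizes[OF G] by (intro Max_ge) auto

lemma packing_number_attained:
  assumes G: "convex_geometric_graph G" "0 < card (edges G)"
  obtains P where "packing G n P" "card P = packing_number n G"
proof -
  have "packing G n {}" unfolding packing_def by simp
  then have "packing_number n G \<in> card ` {P. packing G n P}"
    unfolding packing_number_def using finite_packing_sizes[OF G] by (intro Max_in) auto
  then show thesis using that by (auto simp: image_iff)
qed

section \<open>Copies on vertices of the regular polygon\<close>

definition polygon_list :: "nat \<Rightarrow> nat list \<Rightarrow> complex list" where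
  "polygon_list n js = map (polygon_vertex n) js"

text \<open>The three alternatives say that the indices increase up to a cyclic shift, as happens
  when a rotated copy passes the end of the index range.\<close>

lemma clockwise_listing_polygon_list:
  assumes "distinct js" "set js \<subseteq> {1..n}"
    and "\<And>i j k. i < j \<Longrightarrow> j < k \<Longrightarrow> k < length js \<Longrightarrow>
       js ! i < js ! j \<and> js ! j < js ! k \<or> js ! j < js ! k \<and> js ! k < js ! i \<or>
       js ! k < js ! i \<and> js ! i < js ! j"
  shows "clockwise_listing (set (polygon_list n js)) (polygon_list n js)"
  unfolding clockwise_listing_def
proof (intro conjI allI impI)
  have "inj_on (polygon_vertex n) (set js)"
    using inj_on_polygon_vertex assms(2) by (rule inj_on_subset)
  then show "distinct (polygon_list n js)"
    unfolding polygon_list_def using assms(1) by (simp add: distinct_map)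
  fix i j k assume ijk: "i < j \<and> j < k \<and> k < length (polygon_list n js)"
  then have k: "k < length js" by (simp add: polygon_list_def)
  have r: "1 \<le> js ! a \<and> js ! a \<le> n" if "a < length js" for a
    using assms(2) that by (meson atLeastAtMost_iff in_mono nth_mem)
  consider "js ! i < js ! j \<and> js ! j < js ! k" | "js ! j < js ! k \<and> js ! k < js ! i"
    | "js ! k < js ! i \<and> js ! i < js ! j" using assms(3) ijk k by metis
  then have "clockwise_triple (polygon_vertex n (js ! i)) (polygon_vertex n (js ! j)) (polygon_vertex n (js ! k))"
  proof cases
    case 1 then show ?thesis using r ijk k by (intro clockwise_triple_polygon) auto
  next
    case 2
    then have "clockwise_triple (polygon_vertex n (js ! j)) (polygon_vertex n (js ! k)) (polygon_vertex n (js ! i))"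
      using r ijk k by (intro clockwise_triple_polygon) auto
    then show ?thesis using clockwise_triple_rotate by metis
  next
    case 3
    then have "clockwise_triple (polygon_vertex n (js ! k)) (polygon_vertex n (js ! i)) (polygon_vertex n (js ! j))"
      using r ijk k by (intro clockwise_triple_polygon) auto
    then show ?thesis using clockwise_triple_rotate by metis
  qed
  then show "clockwise_triple (polygon_list n js ! i) (polygon_list n js ! j) (polygon_list n js ! k)"
    using ijk k by (simp add: polygon_list_def)
qed simp

lemma clockwise_listing_sorted:
  assumes "sorted_wrt (<) js" "set js \<subseteq> {1..n}"
  shows "clockwise_listing (set (polygon_list n js)) (polygon_list n js)"
proof (rule clockwise_listing_polygon_list)
  show "distinct js" using assms(1) strict_sorted_iff by blast
qed (use assms in \<open>auto simp: sorted_wrt_iff_nth_less\<close>)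

lemma polygon_list_subset: "set js \<subseteq> {1..n} \<Longrightarrow> set (polygon_list n js) \<subseteq> regular_polygon n"
  unfolding polygon_list_def regular_polygon_def by auto

lemma convex_geometric_graph_listed:
  assumes "set vs \<subseteq> regular_polygon n" "distinct vs"
    and "\<And>e. e \<in> E \<Longrightarrow> e \<subseteq> {..<length vs} \<and> card e = 2"
  shows "convex_geometric_graph (listed_cgg vs E)"
  unfolding convex_geometric_graph_def
proof (intro conjI ballI)
  show "strictly_convex_position (verts (listed_cgg vs E))"
    using assms(1) regular_polygon_sphere by (intro convex_position_circle) (auto simp: listed_cgg_def)
  fix e assume "e \<in> edges (listed_cgg vs E)"
  then obtain d where d: "d \<in> E" "e = (!) vs ` d" by (auto simp: listed_cgg_def)
  show "e \<subseteq> verts (listed_cgg vs E)"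
    using assms(3)[OF d(1)] d(2) by (auto simp: listed_cgg_def)
  have "inj_on ((!) vs) d"
    using inj_on_nth_lessThan[OF assms(2) refl] assms(3)[OF d(1)] by (meson inj_on_subset)
  then show "card e = 2" using assms(3)[OF d(1)] d(2) by (simp add: card_image)
qed (simp add: listed_cgg_def)

lemma card_edges_listed:
  assumes "distinct vs" "\<And>e. e \<in> E \<Longrightarrow> e \<subseteq> {..<length vs}"
  shows "card (edges (listed_cgg vs E)) = card E"
proof -
  have "inj_on ((`) ((!) vs)) E"
    using inj_on_nth_lessThan[OF assms(1) refl] assms(2)
    by (intro inj_onI) (metis inj_on_image_eq_iff)
  then show ?thesis by (simp add: listed_cgg_def card_image)
qed

section \<open>Packings by rotation\<close>

definition pair_edges :: "(nat \<times> nat) list \<Rightarrow> nat set set" where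
  "pair_edges es = (\<lambda>(x, y). {x, y}) ` set es"

definition polygon_graph :: "nat \<Rightarrow> (nat \<times> nat) list \<Rightarrow> cgg" where
  "polygon_graph k es = listed_cgg (polygon_list k [1..<Suc k]) (pair_edges es)"

text \<open>Addition modulo \<open>N\<close> for arguments below \<open>N\<close>, written by cases
  to stay within linear arithmetic.\<close>

definition rotated :: "nat \<Rightarrow> nat \<Rightarrow> nat \<Rightarrow> nat" where
  "rotated N t p = (if p + t < N then p + t else p + t - N)"

lemma rotated_less: "p < N \<Longrightarrow> t < N \<Longrightarrow> rotated N t p < N"
  unfolding rotated_def by auto

lemma rotated_cyclic:
  assumes "a < b" "b < c" "c < N" "t < N"
  shows "rotated N t a < rotated N t b \<and> rotated N t b < rotated N t c \<or>
    rotated N t b < rotated N t c \<and> rotated N t c < rotated N t a \<or>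
    rotated N t c < rotated N t a \<and> rotated N t a < rotated N t b"
  using assms unfolding rotated_def by auto

text \<open>Rotations preserve circular length. A pair determines its rotation unless it is a
  diameter, which the half turn maps to itself.\<close>

lemma rotated_pair_eq:
  assumes pq: "p < q" "q < N" "t < N" and pq': "p' < q'" "q' < N" "t' < N"
    and eq: "{rotated N t p, rotated N t q} = {rotated N t' p', rotated N t' q'}"
  shows "min (q - p) (N - (q - p)) = min (q' - p') (N - (q' - p'))"
    and "p = p' \<Longrightarrow> q = q' \<Longrightarrow> 2 * (q - p) \<noteq> N \<Longrightarrow> t = t'"
proof -
  have c: "rotated N t p = rotated N t' p' \<and> rotated N t q = rotated N t' q' \<or>
      rotated N t p = rotated N t' q' \<and> rotated N t q = rotated N t' p'"
    using eq by (simp add: doubleton_eq_iff)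
  have d: "q - p = q' - p' \<or> q - p = N - (q' - p')"
    using c pq pq' unfolding rotated_def by (auto split: if_splits)
  then show "min (q - p) (N - (q - p)) = min (q' - p') (N - (q' - p'))"
    using pq pq' by auto
  assume "p = p'" "q = q'" "2 * (q - p) \<noteq> N"
  then show "t = t'"
    using c pq pq' unfolding rotated_def by (auto split: if_splits)
qed

text \<open>All copies sit on the first \<open>N\<close> of the \<open>n\<close> vertices and are
  rotated modulo \<open>N\<close>. No symmetry of the \<open>n\<close>-gon is involved: the type of
  a copy depends only on the cyclic order of its own vertices. Circular length modulo
  \<open>N\<close> identifies the base copy and the edge, and \<open>diam\<close> then lets the edge
  determine the rotation.\<close>

lemma rotation_packing:
  fixes pos :: "'i \<Rightarrow> nat \<Rightarrow> nat"
  assumes k: "2 \<le> k" and es: "\<And>x y. (x, y) \<in> set es \<Longrightarrow> x < y \<and> y < k" and ne: "es \<noteq> []"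
    and N: "N \<le> n" and I: "finite I"
    and pos: "\<And>c j. c \<in> I \<Longrightarrow> j < k \<Longrightarrow> pos c j < N"
    and mono: "\<And>c a b. c \<in> I \<Longrightarrow> a < b \<Longrightarrow> b < k \<Longrightarrow> pos c a < pos c b"
    and inj: "\<And>c c' x y x' y'. c \<in> I \<Longrightarrow> c' \<in> I \<Longrightarrow> (x, y) \<in> set es \<Longrightarrow> (x', y') \<in> set es \<Longrightarrow>
      min (pos c y - pos c x) (N - (pos c y - pos c x)) =
      min (pos c' y' - pos c' x') (N - (pos c' y' - pos c' x')) \<Longrightarrow> c = c' \<and> x = x' \<and> y = y'"
    and diam: "\<And>c x y. c \<in> I \<Longrightarrow> (x, y) \<in> set es \<Longrightarrow> 2 * (pos c y - pos c x) \<noteq> N"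
  shows "\<exists>P. packing (polygon_graph k es) n P \<and> card P = card I * N"
proof -
  define js where "js = (\<lambda>(c, t). map (\<lambda>j. Suc (rotated N t (pos c j))) [0..<k])"
  define vs where "vs = (\<lambda>ct. polygon_list n (js ct))"
  define Q where "Q = (\<lambda>ct. listed_cgg (vs ct) (pair_edges es))"
  define J where "J = I \<times> {..<N}"
  have sub: "set (js ct) \<subseteq> {1..n}" if "ct \<in> J" for ct
  proof -
    obtain c t where ct: "ct = (c, t)" "c \<in> I" "t < N" using \<open>ct \<in> J\<close> by (auto simp: J_def)
    have "Suc (rotated N t (pos c j)) \<in> {1..n}" if "j < k" for j
      using rotated_less[OF pos[OF ct(2) that] ct(3)] N by simp
    then show ?thesis using ct by (auto simp: js_def)
  qed
  have len: "length (js ct) = k" for ct by (cases ct) (simp add: js_def)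
  have list: "clockwise_listing (set (vs ct)) (vs ct)" if "ct \<in> J" for ct
  proof -
    obtain c t where ct: "ct = (c, t)" "c \<in> I" "t < N" using \<open>ct \<in> J\<close> by (auto simp: J_def)
    have ri: "rotated N t p \<noteq> rotated N t q" if "p < N" "q < N" "p < q" for p q
      using that ct(3) unfolding rotated_def by auto
    show ?thesis
      unfolding vs_def
    proof (rule clockwise_listing_polygon_list)
      have "inj_on (\<lambda>j. Suc (rotated N t (pos c j))) {..<k}"
      proof (rule linorder_inj_onI')
        fix i j assume "i \<in> {..<k}" "j \<in> {..<k}" "i < j"
        then show "Suc (rotated N t (pos c i)) \<noteq> Suc (rotated N t (pos c j))"
          using ri[of "pos c i" "pos c j"] pos[OF ct(2)] mono[OF ct(2), of i j] by auto
      qed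
      then show "distinct (js ct)" using ct by (simp add: js_def distinct_map atLeast0LessThan)
      show "set (js ct) \<subseteq> {1..n}" using sub that .
      fix i j l assume ijl: "i < j" "j < l" "l < length (js ct)"
      then show "js ct ! i < js ct ! j \<and> js ct ! j < js ct ! l \<or>
        js ct ! j < js ct ! l \<and> js ct ! l < js ct ! i \<or> js ct ! l < js ct ! i \<and> js ct ! i < js ct ! j"
        using rotated_cyclic[of "pos c i" "pos c j" "pos c l" N t] ct len mono[OF ct(2)] pos[OF ct(2)]
        by (simp add: js_def)
    qed
  qed
  have es': "e \<subseteq> {..<k} \<and> card e = 2" if "e \<in> pair_edges es" for e
    using that es by (fastforce simp: pair_edges_def)
  have edge: "\<exists>x y. (x, y) \<in> set es \<and>
      e = polygon_vertex n ` {Suc (rotated N t (pos c x)), Suc (rotated N t (pos c y))}"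
    if "e \<in> edges (Q (c, t))" for e c t
    using that es unfolding Q_def listed_cgg_def pair_edges_def vs_def js_def polygon_list_def
    by fastforce
  have disj: "ct = ct'" if cts: "ct \<in> J" "ct' \<in> J" "edges (Q ct) \<inter> edges (Q ct') \<noteq> {}" for ct ct'
  proof -
    obtain c t where ct: "ct = (c, t)" "c \<in> I" "t < N" using \<open>ct \<in> J\<close> by (auto simp: J_def)
    obtain c' t' where ct': "ct' = (c', t')" "c' \<in> I" "t' < N" using \<open>ct' \<in> J\<close> by (auto simp: J_def)
    obtain e where "e \<in> edges (Q (c, t))" "e \<in> edges (Q (c', t'))" using cts ct ct' by auto
    then obtain x y x' y' where xy: "(x, y) \<in> set es" "(x', y') \<in> set es" and
      ee: "polygon_vertex n ` {Suc (rotated N t (pos c x)), Suc (rotated N t (pos c y))} =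
       polygon_vertex n ` {Suc (rotated N t' (pos c' x')), Suc (rotated N t' (pos c' y'))}"
      using edge by metis
    have b: "x < y" "y < k" "x' < y'" "y' < k" using es xy by auto
    have p: "pos c x < N" "pos c y < N" "pos c' x' < N" "pos c' y' < N" using pos b ct ct' by auto
    have "{Suc (rotated N t (pos c x)), Suc (rotated N t (pos c y))} =
       {Suc (rotated N t' (pos c' x')), Suc (rotated N t' (pos c' y'))}"
      using inj_on_image_eq_iff[OF inj_on_polygon_vertex[of n]] ee rotated_less[OF p(1) ct(3)]
        rotated_less[OF p(2) ct(3)] rotated_less[OF p(3) ct'(3)] rotated_less[OF p(4) ct'(3)] N
      by (smt (verit, ccfv_threshold) Suc_le_eq atLeastAtMost_iff empty_subsetI insert_subset le_trans
          le_add1 plus_1_eq_Suc)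
    then have eq: "{rotated N t (pos c x), rotated N t (pos c y)} =
       {rotated N t' (pos c' x'), rotated N t' (pos c' y')}"
      by (auto simp: doubleton_eq_iff)
    note r = rotated_pair_eq[OF mono[OF ct(2) b(1,2)] p(2) ct(3) mono[OF ct'(2) b(3,4)] p(4) ct'(3) eq]
    have "c = c' \<and> x = x' \<and> y = y'" using inj[OF ct(2) ct'(2) xy r(1)] .
    then show ?thesis using r(2) diam[OF ct(2) xy(1)] ct ct' by simp
  qed
  have nonempty: "edges (Q ct) \<noteq> {}" for ct using ne by (auto simp: Q_def listed_cgg_def pair_edges_def)
  have "inj_on Q J" using disj nonempty by (intro inj_onI) (metis Int_absorb)
  then have "card (Q ` J) = card I * N" by (simp add: card_image J_def card_cartesian_product)
  moreover have "packing (polygon_graph k es) n (Q ` J)"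
    unfolding packing_def
  proof (intro conjI ballI impI)
    fix H assume "H \<in> Q ` J"
    then obtain ct where ct: "ct \<in> J" "H = Q ct" by blast
    have d: "distinct (vs ct)" using list[OF ct(1)] by (simp add: clockwise_listing_def)
    have l: "length (vs ct) = k" using len by (simp add: vs_def polygon_list_def)
    have s: "set (vs ct) \<subseteq> regular_polygon n" unfolding vs_def using sub[OF ct(1)] by (rule polygon_list_subset)
    have g: "convex_geometric_graph H"
      unfolding ct Q_def using s d es' l by (intro convex_geometric_graph_listed) auto
    have v: "verts H = set (vs ct)" by (simp add: ct Q_def listed_cgg_def)
    have "edges H \<subseteq> edges (complete_cgg n)"
      using edges_convex_geometric_graph[OF g] v s by (fastforce simp: complete_cgg_def)
    then show "subgraph H (complete_cgg n)"
      unfolding subgraph_def using g v s by (simp add: complete_cgg_def)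
    have "convex_isomorphic (listed_cgg (vs ct) (pair_edges es))
        (listed_cgg (polygon_list k [1..<Suc k]) ((`) id ` pair_edges es))"
    proof (rule convex_isomorphic_listed[OF list[OF ct(1)] l])
      show "clockwise_listing (set (polygon_list k [1..<Suc k])) (polygon_list k [1..<Suc k])"
        by (rule clockwise_listing_sorted) (auto simp del: upt_Suc)
    qed (use k es' in \<open>auto simp: polygon_list_def\<close>)
    then show "convex_isomorphic H (polygon_graph k es)" by (simp add: ct Q_def polygon_graph_def)
  next
    fix H H' assume "H \<in> Q ` J" "H' \<in> Q ` J" "H \<noteq> H'"
    then show "edges H \<inter> edges H' = {}" using disj by blast
  qed
  ultimately show ?thesis by blast
qed

section \<open>Base copies depending linearly on a parameter\<close>

text \<open>A placement \<open>(p, s, c)\<close> stands for the vertex \<open>p R + s i + c\<close> of a base copy with parameter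
  \<open>i\<close>; the circle is cut into \<open>2 K\<close> cells of \<open>R\<close> consecutive vertices.  The lengths of an edge then
  sweep one cell completely (slope \<open>1\<close>) or two cells in one residue class modulo 2 (slope \<open>2\<close>).
  Parameters stay at distance 2 from \<open>0\<close> and \<open>R\<close>, so the offsets \<open>c\<close> do not lead out of a cell.\<close>

type_synonym placement = "int \<times> int \<times> int"

definition place :: "int \<Rightarrow> int \<Rightarrow> placement \<Rightarrow> int" where
  "place R i = (\<lambda>(p, s, c). p * R + s * i + c)"

text \<open>The circular length of an edge as a function of the parameter. The difference of the two
  placements is replaced by its complement to the full circle if, offsets aside, it is at least half
  the circle at both ends \<open>i = 0\<close> and \<open>i = R\<close>.\<close>

definition edge_track :: "int \<Rightarrow> placement list \<Rightarrow> nat \<times> nat \<Rightarrow> placement" where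
  "edge_track K fam = (\<lambda>(x, y).
     case fam ! x of (p, s, c) \<Rightarrow> case fam ! y of (p', s', c') \<Rightarrow>
       if K \<le> p' - p \<and> K \<le> p' - p + (s' - s) then (2 * K - (p' - p), s - s', c - c')
       else (p' - p, s' - s, c' - c))"

text \<open>In units of \<open>R\<close>, the track runs from \<open>p\<close> to
  \<open>p + s\<close>, and both ends must lie between 0 and the half circle \<open>K\<close>. A
  nonzero slope gives distinct lengths to distinct parameters.\<close>

definition good_track :: "int \<Rightarrow> placement \<Rightarrow> bool" where
  "good_track K = (\<lambda>(p, s, c). s \<noteq> 0 \<and> \<bar>c\<bar> \<le> 1 \<and> 0 \<le> p \<and> 0 \<le> p + s \<and> p \<le> K \<and> p + s \<le> K)"

text \<open>The tracks use separate cells or separate parities: for even \<open>R\<close> and even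
  slope, a length has the parity of its offset.\<close>

definition disjoint_tracks :: "placement \<Rightarrow> placement \<Rightarrow> bool" where
  "disjoint_tracks = (\<lambda>(p, s, c) (p', s', c').
     max p (p + s) \<le> min p' (p' + s') \<or> max p' (p' + s') \<le> min p (p + s) \<or>
     even s \<and> even s' \<and> odd (c - c'))"

text \<open>Vertex 0 can be pinned to the origin because all rotations are taken. The quantifiers
  range over lists to make the condition executable.\<close>

definition valid_families :: "int \<Rightarrow> nat \<Rightarrow> (nat \<times> nat) list \<Rightarrow> placement list list \<Rightarrow> bool" where
  "valid_families K k es fams \<longleftrightarrow>
     (\<forall>fam\<in>set fams. length fam = k \<and> fam ! 0 = (0, 0, 0) \<and>
        (\<forall>e\<in>set es. good_track K (edge_track K fam e))) \<and>
     (\<forall>a\<in>set [0..<length fams]. \<forall>b\<in>set [0..<length fams]. \<forall>e\<in>set es. \<forall>e'\<in>set es.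
        a = b \<and> e = e' \<or>
        disjoint_tracks (edge_track K (fams ! a) e) (edge_track K (fams ! b) e'))"

text \<open>The hull edges are demanded since their tracks guarantee the vertex order: consecutive
  ones make the positions increase, and \<open>(0, k - 1)\<close> keeps the last position within one
  turn.\<close>

definition polygon_edges :: "nat \<Rightarrow> (nat \<times> nat) list \<Rightarrow> bool" where
  "polygon_edges k es \<longleftrightarrow> (\<forall>(x, y)\<in>set es. x < y \<and> y < k) \<and>
     (\<forall>j\<in>set [1..<k]. (j - 1, j) \<in> set es) \<and> (0, k - 1) \<in> set es \<and> distinct es"

text \<open>At distance 2 from both ends of the parameter range, \<open>s * i\<close> and
  \<open>s * (R - i)\<close> have absolute value at least 2, which outweighs the offset.\<close>

lemma good_track_bounds:
  assumes g: "good_track K (p, s, c)" and i: "2 \<le> i" "i \<le> R - 2"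
  shows "min p (p + s) * R < place R i (p, s, c)" "place R i (p, s, c) < max p (p + s) * R"
proof -
  have c: "s \<noteq> 0" "- 1 \<le> c" "c \<le> 1" using g by (auto simp: good_track_def)
  have 1: "1 * 2 \<le> t * u" if "1 \<le> t" "2 \<le> u" for t u :: int
    using that by (intro mult_mono) auto
  have 2: "s * R = s * i + s * (R - i)" by (simp add: algebra_simps)
  have "min p (p + s) * R < place R i (p, s, c) \<and> place R i (p, s, c) < max p (p + s) * R"
  proof (cases "0 < s")
    case True
    then have "2 \<le> s * i" "2 \<le> s * (R - i)" using 1[of s i] 1[of s "R - i"] i by auto
    then show ?thesis using True c 2 unfolding place_def by (simp add: algebra_simps)
  next
    case False
    then have "2 \<le> (- s) * i" "2 \<le> (- s) * (R - i)"
      using 1[of "- s" i] 1[of "- s" "R - i"] i c by auto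
    then show ?thesis using False c 2 unfolding place_def by (simp add: algebra_simps)
  qed
  then show "min p (p + s) * R < place R i (p, s, c)" "place R i (p, s, c) < max p (p + s) * R" by auto
qed

lemma edge_track_place:
  "place R i (edge_track K fam (x, y)) = place R i (fam ! y) - place R i (fam ! x) \<or>
   place R i (edge_track K fam (x, y)) = 2 * K * R - (place R i (fam ! y) - place R i (fam ! x))"
  by (cases "fam ! x"; cases "fam ! y") (auto simp: edge_track_def place_def algebra_simps)

lemma good_track_range:
  assumes g: "good_track K t" and i: "2 \<le> i" "i \<le> R - 2"
  shows "0 < place R i t" "place R i t < K * R"
proof -
  obtain p s c where t: "t = (p, s, c)" by (cases t)
  have R: "0 \<le> R" using i by simp
  have "0 * R \<le> min p (p + s) * R" "max p (p + s) * R \<le> K * R"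
    using g R unfolding t good_track_def by (auto intro!: mult_right_mono simp del: mult_zero_left)
  then show "0 < place R i t" "place R i t < K * R"
    using good_track_bounds[OF g[unfolded t] i] unfolding t by linarith+
qed

lemma disjoint_tracks_neq:
  assumes g: "good_track K t" "good_track K t'" and d: "disjoint_tracks t t'"
    and i: "2 \<le> i" "i \<le> R - 2" "2 \<le> i'" "i' \<le> R - 2" and R: "even R"
  shows "place R i t \<noteq> place R i' t'"
proof -
  obtain p s c where t: "t = (p, s, c)" by (cases t)
  obtain p' s' c' where t': "t' = (p', s', c')" by (cases t')
  have R0: "0 \<le> R" using i by simp
  note b = good_track_bounds[OF g(1)[unfolded t] i(1,2)] good_track_bounds[OF g(2)[unfolded t'] i(3,4)]
  consider "max p (p + s) \<le> min p' (p' + s')" | "max p' (p' + s') \<le> min p (p + s)"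
    | "even s" "even s'" "odd (c - c')"
    using d unfolding t t' disjoint_tracks_def by auto
  then show ?thesis
  proof cases
    case 1
    then have "max p (p + s) * R \<le> min p' (p' + s') * R" using R0 by (rule mult_right_mono)
    then show ?thesis using b unfolding t t' by linarith
  next
    case 2
    then have "max p' (p' + s') * R \<le> min p (p + s) * R" using R0 by (rule mult_right_mono)
    then show ?thesis using b unfolding t t' by linarith
  next
    case 3
    have "place R i t - place R i' t' = ((p - p') * R + s * i - s' * i') + (c - c')"
      unfolding t t' place_def by (simp add: algebra_simps)
    then have "odd (place R i t - place R i' t')" using 3 R by simp
    then show ?thesis by auto
  qed
qed

text \<open>Each family has the \<open>R - 4\<close> parameters from 2 to \<open>R - 3\<close>, and
  each base copy has \<open>2 * K * R\<close> rotations.\<close>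

lemma family_packing:
  assumes v: "valid_families (int K) k es fams" and es: "polygon_edges k es" and k: "2 \<le> k"
    and R: "even R" and N: "2 * K * R \<le> n"
  shows "\<exists>P. packing (polygon_graph k es) n P \<and>
     card P = length fams * (R - 4) * (2 * K * R)"
proof -
  define I where "I = {..<length fams} \<times> {2..<R - 2}"
  define pl where "pl = (\<lambda>(a, i) j. place (int R) (int i) (fams ! a ! j))"
  define tr where "tr = (\<lambda>(a, i) e. place (int R) (int i) (edge_track (int K) (fams ! a) e))"
  have es_less: "x < y \<and> y < k" if "(x, y) \<in> set es" for x y
    using es that unfolding polygon_edges_def by auto
  have good: "good_track (int K) (edge_track (int K) (fams ! a) e)"
    if "a < length fams" "e \<in> set es" for a e
    using v that unfolding valid_families_def by (meson nth_mem)
  have par: "2 \<le> int i" "int i \<le> int R - 2" if "(a, i) \<in> I" for a i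
    using that unfolding I_def by auto
  have rng: "0 < tr c e \<and> tr c e < int K * int R" if "c \<in> I" "e \<in> set es" for c e
  proof -
    obtain a i where c: "c = (a, i)" by (cases c)
    then have "a < length fams" using that by (auto simp: I_def)
    then have g: "good_track (int K) (edge_track (int K) (fams ! a) e)" using good that(2) by blast
    show ?thesis
      using good_track_range[OF g, of "int i" "int R"] par[of a i] that(1) unfolding tr_def c by simp
  qed
  have trpl: "tr c (x, y) = pl c y - pl c x \<or> tr c (x, y) = 2 * int K * int R - (pl c y - pl c x)"
    for c x y
    unfolding tr_def pl_def using edge_track_place by (cases c) auto
  \<comment> \<open>Whichever alternative of \<open>trpl\<close> holds, a track strictly between 0
    and the half circle puts the difference strictly between 0 and the full circle and away from the
    half circle. Hence the vertex order need not be checked separately.\<close>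
  have diff: "0 < pl c y - pl c x \<and> pl c y - pl c x < 2 * int K * int R \<and>
      tr c (x, y) = min (pl c y - pl c x) (2 * int K * int R - (pl c y - pl c x)) \<and>
      2 * (pl c y - pl c x) \<noteq> 2 * int K * int R"
    if "c \<in> I" "(x, y) \<in> set es" for c x y
    using trpl[of c x y] rng[OF that] by auto
  have step: "pl c j < pl c (Suc j)" if "c \<in> I" "Suc j < k" for c j
  proof -
    have "Suc j \<in> set [1..<k]" using that(2) by simp
    then have "(Suc j - 1, Suc j) \<in> set es" using es unfolding polygon_edges_def by blast
    then show ?thesis using diff[OF that(1), of j "Suc j"] by simp
  qed
  have mono: "pl c a < pl c b" if "c \<in> I" "a < b" "b < k" for c a b
    using that(2,3)
  proof (induction b)
    case (Suc b)
    then show ?case using step[OF that(1), of b] by (cases "a = b") auto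
  qed simp
  have p0: "pl c 0 = 0" if "c \<in> I" for c
  proof -
    obtain a i where c: "c = (a, i)" by (cases c)
    then have "fams ! a ! 0 = (0, 0, 0)"
      using v that unfolding valid_families_def I_def by auto
    then show ?thesis by (simp add: pl_def c place_def)
  qed
  have p1: "pl c (k - 1) < 2 * int K * int R" if "c \<in> I" for c
  proof -
    have "(0, k - 1) \<in> set es" using es unfolding polygon_edges_def by blast
    then show ?thesis using diff[OF that, of 0 "k - 1"] p0[OF that] by simp
  qed
  have bound: "0 \<le> pl c j \<and> pl c j < 2 * int K * int R" if "c \<in> I" "j < k" for c j
  proof -
    have "pl c 0 \<le> pl c j" using mono[OF that(1), of 0 j] that by (cases "j = 0") auto
    moreover have "j = k - 1 \<or> j < k - 1" using that(2) by linarith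
    then have "pl c j \<le> pl c (k - 1)" using mono[OF that(1), of j "k - 1"] k by auto
    ultimately show ?thesis using p0[OF that(1)] p1[OF that(1)] by simp
  qed
  define pos where "pos = (\<lambda>c j. nat (pl c j))"
  have pos_int: "int (pos c j) = pl c j" if "c \<in> I" "j < k" for c j
    using bound[OF that] by (simp add: pos_def)
  have len: "int (min (pos c y - pos c x) (2 * K * R - (pos c y - pos c x))) = tr c (x, y)"
    and len2: "2 * (pos c y - pos c x) \<noteq> 2 * K * R"
    if "c \<in> I" "(x, y) \<in> set es" for c x y
  proof -
    have xy: "x < k" "y < k" using es_less[OF that(2)] by auto
    note d = diff[OF that] pos_int[OF that(1) xy(1)] pos_int[OF that(1) xy(2)]
    have 1: "int (pos c y - pos c x) = pl c y - pl c x" using d by (simp add: of_nat_diff)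
    have 2: "int (2 * K * R) = 2 * int K * int R" by simp
    have 3: "int (2 * K * R - (pos c y - pos c x)) = 2 * int K * int R - (pl c y - pl c x)"
      using d 1 2 by linarith
    show "int (min (pos c y - pos c x) (2 * K * R - (pos c y - pos c x))) = tr c (x, y)"
      using d unfolding of_nat_min 1 3 by simp
    have 4: "int (2 * (pos c y - pos c x)) = 2 * (pl c y - pl c x)" unfolding of_nat_mult 1 by simp
    show "2 * (pos c y - pos c x) \<noteq> 2 * K * R"
    proof
      assume "2 * (pos c y - pos c x) = 2 * K * R"
      then have "2 * (pl c y - pl c x) = 2 * int K * int R" using 2 4 by metis
      then show False using d by blast
    qed
  qed
  have "\<exists>P. packing (polygon_graph k es) n P \<and> card P = card I * (2 * K * R)"
  proof (rule rotation_packing[where pos = pos])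
    show "2 \<le> k" "2 * K * R \<le> n" by fact+
    show "x < y \<and> y < k" if "(x, y) \<in> set es" for x y using es_less that .
    show "es \<noteq> []" using es unfolding polygon_edges_def by auto
    show "finite I" by (simp add: I_def)
    show "pos c j < 2 * K * R" if "c \<in> I" "j < k" for c j
      using bound[OF that] by (simp add: pos_def nat_less_iff)
    show "pos c a < pos c b" if "c \<in> I" "a < b" "b < k" for c a b
      using mono[OF that] pos_int[of c a] pos_int[of c b] that by auto
    show "2 * (pos c y - pos c x) \<noteq> 2 * K * R" if "c \<in> I" "(x, y) \<in> set es" for c x y
      using len2 that .
    show "c = c' \<and> x = x' \<and> y = y'"
      if c: "c \<in> I" "c' \<in> I" and xy: "(x, y) \<in> set es" "(x', y') \<in> set es"
        and eq: "min (pos c y - pos c x) (2 * K * R - (pos c y - pos c x)) =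
          min (pos c' y' - pos c' x') (2 * K * R - (pos c' y' - pos c' x'))" for c c' x y x' y'
    proof -
      have t: "tr c (x, y) = tr c' (x', y')"
        using len[OF c(1) xy(1)] len[OF c(2) xy(2)] eq by simp
      obtain a i where ai: "c = (a, i)" by (cases c)
      obtain a' i' where ai': "c' = (a', i')" by (cases c')
      have a: "a < length fams" "a' < length fams" using c ai ai' by (auto simp: I_def)
      note g = good[OF a(1) xy(1)] good[OF a(2) xy(2)]
      note p = par[of a i] par[of a' i']
      have "\<not> disjoint_tracks (edge_track (int K) (fams ! a) (x, y)) (edge_track (int K) (fams ! a') (x', y'))"
        using disjoint_tracks_neq[OF g _ p(1,2)[OF c(1)[unfolded ai]] p(3,4)[OF c(2)[unfolded ai']]] R t
        unfolding tr_def ai ai' by auto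
      moreover have "a \<in> set [0..<length fams]" "a' \<in> set [0..<length fams]" using a by auto
      ultimately have same: "a = a' \<and> (x, y) = (x', y')"
        using v xy unfolding valid_families_def by blast
      obtain p s cc where T: "edge_track (int K) (fams ! a) (x, y) = (p, s, cc)" by (meson prod_cases3)
      have "s \<noteq> 0" using g(1) unfolding T good_track_def by simp
      moreover have "s * int i = s * int i'"
        using t same T unfolding tr_def ai ai' place_def by simp
      ultimately show ?thesis using same ai ai' by simp
    qed
  qed
  moreover have "card I = length fams * (R - 4)" by (simp add: I_def card_cartesian_product)
  ultimately show ?thesis by simp
qed

lemma card_pair_edges:
  assumes "\<And>x y. (x, y) \<in> set es \<Longrightarrow> x < y" "distinct es"
  shows "card (pair_edges es) = length es"
proof -
  have "inj_on (\<lambda>(x, y). {x, y}) (set es)"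
  proof (rule inj_onI, clarify)
    fix x y x' y' assume a: "(x, y) \<in> set es" "(x', y') \<in> set es" "{x, y} = {x', y'}"
    show "x = x' \<and> y = y'"
      using assms(1)[OF a(1)] assms(1)[OF a(2)] a(3) by (auto simp: doubleton_eq_iff)
  qed
  then show ?thesis using assms(2) by (simp add: pair_edges_def card_image distinct_card)
qed

lemma convex_geometric_polygon_graph:
  assumes "polygon_edges k es"
  shows "convex_geometric_graph (polygon_graph k es)"
    and "card (edges (polygon_graph k es)) = length es"
proof -
  have es: "\<And>x y. (x, y) \<in> set es \<Longrightarrow> x < y \<and> y < k" "distinct es"
    using assms unfolding polygon_edges_def by auto
  have e: "e \<subseteq> {..<k} \<and> card e = 2" if "e \<in> pair_edges es" for e
    using that es(1) by (fastforce simp: pair_edges_def)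
  have L: "clockwise_listing (set (polygon_list k [1..<Suc k])) (polygon_list k [1..<Suc k])"
    by (rule clockwise_listing_sorted) (auto simp del: upt_Suc)
  then have d: "distinct (polygon_list k [1..<Suc k])" by (simp add: clockwise_listing_def)
  have l: "length (polygon_list k [1..<Suc k]) = k" by (simp add: polygon_list_def)
  have s: "set (polygon_list k [1..<Suc k]) \<subseteq> regular_polygon k"
    by (rule polygon_list_subset) auto
  show "convex_geometric_graph (polygon_graph k es)"
    unfolding polygon_graph_def using s d e l by (intro convex_geometric_graph_listed) auto
  show "card (edges (polygon_graph k es)) = length es"
    unfolding polygon_graph_def
    using card_edges_listed[OF d, of "pair_edges es"] e l card_pair_edges[of es] es by auto
qed

text \<open>There are as many cells as tracks. The copies therefore cover
  \<open>K * (R - 4) * N\<close> pairs with \<open>N = 2 * K * R\<close>, which is asymptotically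
  \<open>N^2 / 2\<close>.\<close>

lemma convex_packable_families:
  assumes v: "valid_families (int K) k es fams" and es: "polygon_edges k es" and k: "2 \<le> k"
    and K: "K = length fams * length es" "0 < K"
  shows "convex_packable (polygon_graph k es)"
proof -
  let ?G = "polygon_graph k es"
  let ?e = "length es"
  let ?r = "\<lambda>n. real (packing_number n ?G) * real (card (edges ?G)) / real (n choose 2)"
  have G: "convex_geometric_graph ?G" "card (edges ?G) = ?e" using convex_geometric_polygon_graph[OF es] by auto
  have e0: "0 < card (edges ?G)" using K G by auto
  have ch: "real (n choose 2) = real n * (real n - 1) / 2" for n
    by (cases n) (auto simp: choose_two field_simps real_of_nat_div)
  have upper: "?r n \<le> 1" for n
  proof -
    obtain P where P: "packing ?G n P" "card P = packing_number n ?G"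
      using packing_number_attained[OF G(1) e0] by metis
    have "real (card P * card (edges ?G)) \<le> real (n choose 2)"
      using card_packing_le[OF G(1) e0 P(1)] by (rule of_nat_mono)
    then show ?thesis using P(2) by (auto simp: divide_le_eq)
  qed
  \<comment> \<open>Rounding \<open>n\<close> down to a usable circle loses less than
    \<open>4 * K\<close>. The bound \<open>12 * K\<close> adds \<open>8 * K\<close> for the four
    parameters discarded in each cell.\<close>
  have lower: "(1 - real (12 * K) / real n) * (1 - real (4 * K) / real n) \<le> ?r n" if n: "12 * K \<le> n" for n
  proof -
    \<comment> \<open>The parity argument needs \<open>R\<close> even, so \<open>2 * K * R\<close>
      is the largest multiple of \<open>4 * K\<close> up to \<open>n\<close>.\<close>
    define R where "R = 2 * (n div (4 * K))"
    have NR: "2 * K * R = n div (4 * K) * (4 * K)" by (simp add: R_def)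
    have Nn: "2 * K * R \<le> n" unfolding NR by (rule div_times_less_eq_dividend)
    have "n < n div (4 * K) * (4 * K) + 4 * K"
      using div_mult_mod_eq[of n "4 * K"] mod_less_divisor[of "4 * K" n] K(2) by linarith
    then have nN: "real n - 4 * real K \<le> 2 * real K * real R"
      unfolding NR[symmetric] by (metis (mono_tags, opaque_lifting) add.commute diff_le_eq less_imp_le of_nat_add of_nat_le_iff of_nat_mult of_nat_numeral)
    obtain P where P: "packing ?G n P" "card P = length fams * (R - 4) * (2 * K * R)"
      using family_packing[OF v es k _ Nn] unfolding R_def by auto
    have "card P * ?e = K * (R - 4) * (2 * K * R)" using P(2) K(1) by simp
    then have "real (card P * ?e) = real (K * (R - 4) * (2 * K * R))" by (rule arg_cong)
    then have "real (card P) * real ?e = real K * real (R - 4) * (2 * real K * real R)"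
      by (simp only: of_nat_mult of_nat_numeral)
    moreover have "real R - 4 \<le> real (R - 4)" by linarith
    ultimately have "(real K * (real R - 4)) * (2 * real K * real R) \<le> real (card P) * real ?e"
      by (simp add: mult_right_mono mult_left_mono)
    moreover have "(real n - 12 * real K) / 2 * (real n - 4 * real K) \<le> (real K * (real R - 4)) * (2 * real K * real R)"
    proof (rule mult_mono)
      have nN': "real n - 4 * real K \<le> 2 * (real K * real R)" using nN by (simp only: mult.assoc)
      have K4: "real K * (real R - 4) = real K * real R - 4 * real K" by (simp add: algebra_simps)
      have "(real n - 12 * real K) / 2 = (real n - 4 * real K) / 2 - 4 * real K" by (simp add: field_simps)
      also have "\<dots> \<le> 2 * (real K * real R) / 2 - 4 * real K"
        using nN' by (intro diff_right_mono divide_right_mono) auto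
      finally show "(real n - 12 * real K) / 2 \<le> real K * (real R - 4)" unfolding K4 by simp
      have "real (12 * K) \<le> real n" using n by (rule of_nat_mono)
      then show "0 \<le> real n - 4 * real K" "0 \<le> real K * (real R - 4)" unfolding K4 using nN' by simp_all
    qed (use nN in simp)
    moreover have "real (card P) * real ?e \<le> real (packing_number n ?G) * real ?e"
      using packing_number_ge[OF G(1) e0 P(1)] by (intro mult_right_mono) auto
    ultimately have main: "(real n - 12 * real K) * (real n - 4 * real K) / 2 \<le> real (packing_number n ?G) * real ?e"
      by linarith
    have n2: "12 \<le> real n" using n K(2) by linarith
    have n12: "real (12 * K) \<le> real n" using n by (rule of_nat_mono)
    have "(1 - real (12 * K) / real n) * (1 - real (4 * K) / real n) =
        ((real n - 12 * real K) * (real n - 4 * real K) / 2) / (real n * real n / 2)"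
      using n2 by (simp add: field_simps)
    also have "\<dots> \<le> ((real n - 12 * real K) * (real n - 4 * real K) / 2) / real (n choose 2)"
    proof (rule divide_left_mono)
      show "real (n choose 2) \<le> real n * real n / 2" unfolding ch using n2 by (simp add: mult_left_mono)
      show "0 \<le> (real n - 12 * real K) * (real n - 4 * real K) / 2" using n12 by simp
      show "0 < real n * real n / 2 * real (n choose 2)" unfolding ch using n2 by simp
    qed
    also have "\<dots> \<le> ?r n" using main G(2) by (intro divide_right_mono) auto
    finally show ?thesis .
  qed
  have "(\<lambda>n. (1 - real (12 * K) / real n) * (1 - real (4 * K) / real n)) \<longlonglongrightarrow> (1 - 0) * (1 - 0)"
    by (intro tendsto_intros lim_const_over_n)
  then have lim: "(\<lambda>n. (1 - real (12 * K) / real n) * (1 - real (4 * K) / real n)) \<longlonglongrightarrow> 1" by simp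
  show ?thesis
    unfolding convex_packable_def
  proof (rule tendsto_sandwich[OF _ _ lim tendsto_const])
    show "\<forall>\<^sub>F n in sequentially. (1 - real (12 * K) / real n) * (1 - real (4 * K) / real n) \<le> ?r n"
      using lower eventually_sequentially by blast
    show "\<forall>\<^sub>F n in sequentially. ?r n \<le> 1" using upper by simp
  qed
qed

section \<open>The six packable graphs\<close>

definition hull_list :: "nat \<Rightarrow> (nat \<times> nat) list" where
  "hull_list k = (0, k - 1) # map (\<lambda>j. (j, Suc j)) [0..<k - 1]"

lemma pair_edges_append: "pair_edges (xs @ ys) = pair_edges xs \<union> pair_edges ys"
  unfolding pair_edges_def by auto

lemma pair_edges_hull_list:
  assumes "2 \<le> k"
  shows "pair_edges (hull_list k) = hull_pairs k"
proof -
  obtain m where m: "k = Suc m" using assms by (cases k) auto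
  show ?thesis unfolding m hull_pairs_Suc
    by (auto simp: pair_edges_def hull_list_def image_iff insert_commute)
qed

lemma nth_polygon_list: "j < k \<Longrightarrow> polygon_list n [1..<Suc k] ! j = polygon_vertex n (Suc j)"
  unfolding polygon_list_def by (simp del: upt_Suc)

lemma clockwise_listing_polygon:
  "clockwise_listing (set (polygon_list k [1..<Suc k])) (polygon_list k [1..<Suc k])"
  by (rule clockwise_listing_sorted) (auto simp del: upt_Suc)

lemma length_polygon_list: "length (polygon_list n js) = length js"
  by (simp add: polygon_list_def)

lemma set_polygon_list: "set (polygon_list k [1..<Suc k]) = regular_polygon k"
  unfolding polygon_list_def regular_polygon_def by (simp add: atLeastLessThanSuc_atLeastAtMost del: upt_Suc)

text \<open>Translates vertices numbered from 1 into list positions numbered from 0.\<close>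

lemma cycle_with_chords_eq:
  assumes k: "2 \<le> k" and cs: "\<And>x y. (x, y) \<in> set cs \<Longrightarrow> x < k \<and> y < k"
  shows "cycle_with_chords k ((\<lambda>(x, y). (Suc x, Suc y)) ` set cs) = polygon_graph k (hull_list k @ cs)"
proof -
  let ?vs = "polygon_list k [1..<Suc k]"
  have "extremal_pairs (regular_polygon k) = (`) ((!) ?vs) ` pair_edges (hull_list k)"
    using extremal_pairs_listed[OF clockwise_listing_polygon[of k], unfolded set_polygon_list length_polygon_list] k
    by (simp add: pair_edges_hull_list del: upt_Suc)
  moreover have "(\<lambda>(i, j). {polygon_vertex k i, polygon_vertex k j}) ` (\<lambda>(x, y). (Suc x, Suc y)) ` set cs =
      (`) ((!) ?vs) ` pair_edges cs"
    unfolding pair_edges_def image_image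
  proof (intro image_cong refl)
    fix e assume "e \<in> set cs"
    then obtain a b where e: "e = (a, b)" and ab: "a < k" "b < k"
      using cs by (metis surj_pair)
    have "(case (Suc a, Suc b) of (i, j) \<Rightarrow> {polygon_vertex k i, polygon_vertex k j}) =
        (!) ?vs ` {a, b}"
      unfolding image_insert image_empty nth_polygon_list[OF ab(1)] nth_polygon_list[OF ab(2)] by simp
    then show "(case case e of (x, y) \<Rightarrow> (Suc x, Suc y) of (i, j) \<Rightarrow>
        {polygon_vertex k i, polygon_vertex k j}) = (!) ?vs ` (case e of (x, y) \<Rightarrow> {x, y})"
      unfolding e by (simp only: split)
  qed
  ultimately show ?thesis
    unfolding cycle_with_chords_def convex_cycle_def polygon_graph_def listed_cgg_def
    unfolding set_polygon_list pair_edges_append image_Un by simp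
qed

lemma convex_cycle_eq: "2 \<le> k \<Longrightarrow> convex_cycle k = polygon_graph k (hull_list k)"
  using cycle_with_chords_eq[of k "[]"] by (simp add: cycle_with_chords_def convex_cycle_def)

lemma Theta_eq:
  "Theta1 = polygon_graph 4 (hull_list 4 @ [(1, 3)])"
  "Theta2 = polygon_graph 5 (hull_list 5 @ [(0, 2), (0, 3)])"
  "Theta3 = polygon_graph 6 (hull_list 6 @ [(1, 3), (1, 4), (0, 4)])"
  "Theta4 = polygon_graph 6 (hull_list 6 @ [(1, 3), (1, 4), (1, 5)])"
  unfolding Theta1_def Theta2_def Theta3_def Theta4_def
  by (subst cycle_with_chords_eq[symmetric]; force simp: eval_nat_numeral)+

text \<open>The families were found by computer search.\<close>

lemma convex_packable_convex_cycle_3: "convex_packable (convex_cycle 3)"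
  unfolding convex_cycle_eq[of 3, simplified]
proof (rule convex_packable_families)
  \<comment> \<open>The two edges of slope 2 share the two lowest cells, one taking the even lengths
    and the other the odd ones. The remaining four edges take one cell each.\<close>
  show "valid_families (int 6) 3 (hull_list 3)
    [[(0, 0, 0), (0, 2, 0), (5, 1, 0)], [(0, 0, 0), (0, 2, 1), (3, 1, 0)]]"
    by code_simp
  show "polygon_edges 3 (hull_list 3)" by code_simp
qed (simp_all add: hull_list_def)

text \<open>The four edges have slopes 1 or -1 and fill the four cells, so one family suffices and
  parity does not enter.\<close>

lemma convex_packable_convex_cycle_4: "convex_packable (convex_cycle 4)"
  unfolding convex_cycle_eq[of 4, simplified]
proof (rule convex_packable_families)
  show "valid_families (int 4) 4 (hull_list 4) [[(0, 0, 0), (0, 1, 0), (4, 0, 0), (5, 1, 0)]]"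
    by code_simp
  show "polygon_edges 4 (hull_list 4)" by code_simp
qed (simp_all add: hull_list_def)

lemma convex_packable_Theta1: "convex_packable Theta1"
  unfolding Theta_eq
proof (rule convex_packable_families)
  show "valid_families (int 10) 4 (hull_list 4 @ [(1, 3)])
    [[(0, 0, 0), (10, 1, 0), (10, 3, 0), (16, 2, 0)],
     [(0, 0, 0), (11, 1, 0), (13, 3, 1), (18, 2, 1)]]"
    by code_simp
  show "polygon_edges 4 (hull_list 4 @ [(1, 3)])" by code_simp
qed (simp_all add: hull_list_def)

lemma convex_packable_Theta2: "convex_packable Theta2"
  unfolding Theta_eq
proof (rule convex_packable_families)
  show "valid_families (int 14) 5 (hull_list 5 @ [(0, 2), (0, 3)])
    [[(0, 0, 0), (0, 2, 0), (6, 1, 0), (10, -1, 0), (17, 1, 0)],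
     [(0, 0, 0), (5, -1, 0), (12, 1, 1), (14, -1, 0), (16, 1, 1)]]"
    by code_simp
  show "polygon_edges 5 (hull_list 5 @ [(0, 2), (0, 3)])" by code_simp
qed (simp_all add: hull_list_def)

lemma convex_packable_Theta3: "convex_packable Theta3"
  unfolding Theta_eq
proof (rule convex_packable_families)
  show "valid_families (int 18) 6 (hull_list 6 @ [(1, 3), (1, 4), (0, 4)])
    [[(0, 0, 0), (2, -2, 0), (7, -1, 0), (15, -3, 0), (17, -1, 0), (25, 1, 0)],
     [(0, 0, 0), (4, -2, 1), (8, -1, 0), (18, -3, 1), (18, -1, 0), (24, 1, 1)]]"
    by code_simp
  show "polygon_edges 6 (hull_list 6 @ [(1, 3), (1, 4), (0, 4)])" by code_simp
qed (simp_all add: hull_list_def)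

lemma convex_packable_Theta4: "convex_packable Theta4"
  unfolding Theta_eq
proof (rule convex_packable_families)
  show "valid_families (int 18) 6 (hull_list 6 @ [(1, 3), (1, 4), (1, 5)])
    [[(0, 0, 0), (11, -1, 0), (16, 0, 0), (24, -2, 0), (26, 0, 0), (28, -2, 0)],
     [(0, 0, 0), (12, -1, 0), (16, 0, 0), (26, -2, 1), (26, 0, 0), (30, -2, 1)]]"
    by code_simp
  show "polygon_edges 6 (hull_list 6 @ [(1, 3), (1, 4), (1, 5)])" by code_simp
qed (simp_all add: hull_list_def)

section \<open>Plane Hamiltonian graphs\<close>

definition noncrossing :: "nat set set \<Rightarrow> bool" where
  "noncrossing E \<longleftrightarrow> (\<forall>i j l m. i < j \<longrightarrow> j < l \<longrightarrow> l < m \<longrightarrow> \<not> ({i, l} \<in> E \<and> {j, m} \<in> E))"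

lemma noncrossing_separates:
  assumes "noncrossing E" "{a, b} \<in> E" "{x, y} \<in> E" "a < x" "x < b"
  shows "a \<le> y" "y \<le> b"
  using assms unfolding noncrossing_def by (metis insert_commute not_le)+

lemma card_hull_pairs:
  assumes "3 \<le> k"
  shows "card (hull_pairs k) = k"
proof -
  obtain m where m: "k = Suc m" using assms by (cases k) auto
  have "{m, 0} \<notin> (\<lambda>i. {i, Suc i}) ` {..<m}" using assms m by (auto simp: doubleton_eq_iff)
  moreover have "card ((\<lambda>i. {i, Suc i}) ` {..<m}) = m"
    by (subst card_image) (auto simp: inj_on_def doubleton_eq_iff)
  ultimately show ?thesis unfolding m hull_pairs_Suc by simp
qed

lemma finite_hull_pairs: "finite (hull_pairs k)"
  unfolding hull_pairs_def by simp

lemma hull_pairs_iff: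
  assumes "x < y" "y < k"
  shows "{x, y} \<in> hull_pairs k \<longleftrightarrow> y = Suc x \<or> x = 0 \<and> y = k - 1"
proof -
  obtain m where m: "k = Suc m" using assms by (cases k) auto
  show ?thesis using assms unfolding m hull_pairs_Suc by (auto simp: doubleton_eq_iff image_iff)
qed

text \<open>The rest of a Hamiltonian cycle through a chord would have to pass from one side of the chord
  to the other, so a plane Hamiltonian cycle is the hull.\<close>

lemma hamiltonian_hull:
  assumes nc: "noncrossing E" and h: "bij_betw h {..<k} {..<k}" and k: "3 \<le> k"
    and cyc: "(`) h ` hull_pairs k \<subseteq> E"
  shows "hull_pairs k \<subseteq> E"
proof -
  have hi: "inj_on h {..<k}" and hs: "h ` {..<k} = {..<k}" using h by (auto simp: bij_betw_def)
  have E: "{h i, h (Suc i mod k)} \<in> E" if "i < k" for i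
  proof -
    have "{i, Suc i mod k} \<in> hull_pairs k" using that unfolding hull_pairs_def by blast
    then have "h ` {i, Suc i mod k} \<in> (`) h ` hull_pairs k" by (rule imageI)
    then show ?thesis using cyc by auto
  qed
  have hull: "{h i, h (Suc i mod k)} \<in> hull_pairs k" if i: "i < k" for i
  proof (rule ccontr)
    assume no: "\<not> ?thesis"
    \<comment> \<open>The Hamiltonian cycle is read from position \<open>Suc i\<close> on, so that
      the supposed chord joins its last vertex \<open>g (k - 1)\<close> to its first vertex
      \<open>g 0\<close>.\<close>
    define g where "g = (\<lambda>t. h ((Suc i + t) mod k))"
    have gh: "\<exists>t<k. j = (Suc i + t) mod k" if "j < k" for j
    proof (cases "Suc i \<le> j")
      case True then show ?thesis using that by (intro exI[of _ "j - Suc i"]) simp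
    next
      case False
      then have "Suc i + (j + k - Suc i) = j + k" "j + k - Suc i < k" using i by auto
      then show ?thesis using that by (intro exI[of _ "j + k - Suc i"]) simp
    qed
    have gs: "\<exists>t<k. g t = v" if "v < k" for v
    proof -
      have "v \<in> h ` {..<k}" using that hs by simp
      then obtain j where j: "j < k" "v = h j" by auto
      obtain t where "t < k" "j = (Suc i + t) mod k" using gh[OF j(1)] by auto
      then show ?thesis using j(2) unfolding g_def by auto
    qed
    have gk: "g t < k" for t
    proof -
      have "(Suc i + t) mod k < k" using k by simp
      then show ?thesis using hs unfolding g_def by blast
    qed
    have "card (g ` {..<k}) = card {..<k}"
    proof -
      have "g ` {..<k} = {..<k}" using gs gk by (auto simp: image_iff set_eq_iff)
      then show ?thesis by simp
    qed
    then have gi: "inj_on g {..<k}" by (intro eq_card_imp_inj_on) auto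
    have gE: "{g t, g (Suc t)} \<in> E" for t
      using E[of "(Suc i + t) mod k"] k unfolding g_def by (simp add: mod_Suc_eq)
    have g0: "g 0 = h (Suc i mod k)" by (simp add: g_def)
    have g1: "g (k - 1) = h i" using i unfolding g_def by simp
    define a b where "a = min (g 0) (g (k - 1))" and "b = max (g 0) (g (k - 1))"
    have "g 0 \<noteq> g (k - 1)" using inj_onD[OF gi, of 0 "k - 1"] k by auto
    then have ab: "a < b" "b < k" "{a, b} = {h i, h (Suc i mod k)}"
      unfolding a_def b_def using gk[of 0] gk[of "k - 1"] g0 g1 by (auto simp: min_def max_def)
    then have abE: "{a, b} \<in> E" using E[OF i] by simp
    have nab: "b \<noteq> Suc a" "\<not> (a = 0 \<and> b = k - 1)" using no ab hull_pairs_iff[of a b k] by auto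
    have gne: "g t \<noteq> a" "g t \<noteq> b" if "1 \<le> t" "t < k - 1" for t
    proof -
      have "t < k" "t \<noteq> 0" "t \<noteq> k - 1" using that by auto
      then have "g t \<noteq> g 0" "g t \<noteq> g (k - 1)"
        using inj_onD[OF gi, of t 0] inj_onD[OF gi, of t "k - 1"] by auto
      then show "g t \<noteq> a" "g t \<noteq> b" unfolding a_def b_def by (auto simp: min_def max_def)
    qed
    have side: "a < g t \<and> g t < b \<longleftrightarrow> a < g (Suc t) \<and> g (Suc t) < b" if "1 \<le> t" "Suc t < k - 1" for t
    proof -
      have r: "{g (Suc t), g t} \<in> E" using gE[of t] by (simp add: insert_commute)
      have n: "g t \<noteq> a" "g t \<noteq> b" "g (Suc t) \<noteq> a" "g (Suc t) \<noteq> b"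
        using gne[of t] gne[of "Suc t"] that by simp_all
      show ?thesis
      proof
        assume "a < g t \<and> g t < b"
        then have "a \<le> g (Suc t)" "g (Suc t) \<le> b" using noncrossing_separates[OF nc abE gE] by blast+
        then show "a < g (Suc t) \<and> g (Suc t) < b" using n by linarith
      next
        assume "a < g (Suc t) \<and> g (Suc t) < b"
        then have "a \<le> g t" "g t \<le> b" using noncrossing_separates[OF nc abE r] by blast+
        then show "a < g t \<and> g t < b" using n by linarith
      qed
    qed
    \<comment> \<open>The vertices from \<open>g 1\<close> to \<open>g (k - 2)\<close> form a path
      that avoids both ends of the chord, so no step of it can change sides.\<close>
    have same: "a < g t \<and> g t < b \<longleftrightarrow> a < g 1 \<and> g 1 < b" if "1 \<le> t" "t < k - 1" for t
      using that
    proof (induction t rule: dec_induct)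
      case (step t)
      then show ?case using side[of t] by simp
    qed simp
    have inner: "\<exists>t. 1 \<le> t \<and> t < k - 1 \<and> g t = v" if v: "v < k" "v \<noteq> a" "v \<noteq> b" for v
    proof -
      obtain t where t: "t < k" "g t = v" using gs v by blast
      have "v \<noteq> g 0" "v \<noteq> g (k - 1)"
        using v unfolding a_def b_def by (auto simp: min_def max_def split: if_splits)
      then have "t \<noteq> 0" "t \<noteq> k - 1" using t(2) by metis+
      then have "1 \<le> t" "t < k - 1" using t(1) by linarith+
      then show ?thesis using t(2) by blast
    qed
    \<comment> \<open>A pair outside the hull has vertices on both sides: \<open>Suc a\<close> on
      the inside, and 0 or \<open>k - 1\<close> on the outside.\<close>
    obtain t1 where t1: "1 \<le> t1" "t1 < k - 1" "g t1 = Suc a"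
      using inner[of "Suc a"] ab nab by auto
    have in1: "a < g 1 \<and> g 1 < b" using same[OF t1(1,2)] t1(3) ab nab by simp
    have "\<exists>v<k. v < a \<or> b < v"
    proof (cases "a = 0")
      case True
      then have "k - 1 < k" "b < k - 1" using nab ab by auto
      then show ?thesis by blast
    next
      case False then show ?thesis using ab by (intro exI[of _ 0]) auto
    qed
    then obtain v where v: "v < k" "v < a \<or> b < v" by blast
    then obtain t where t: "1 \<le> t" "t < k - 1" "g t = v" using inner[of v] ab(1) by auto
    then show False using same[OF t(1,2)] in1 v by simp
  qed
  have sub: "(`) h ` hull_pairs k \<subseteq> hull_pairs k"
    using hull unfolding hull_pairs_def by fastforce
  have "inj_on ((`) h) (hull_pairs k)"
    using hi hull_pairs_subset by (intro inj_onI) (metis inj_on_image_eq_iff)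
  then have "card ((`) h ` hull_pairs k) = card (hull_pairs k)" by (rule card_image)
  then have "(`) h ` hull_pairs k = hull_pairs k" using sub finite_hull_pairs by (intro card_subset_eq) auto
  then show ?thesis using cyc by simp
qed

text \<open>Induction on the width of the interval. The pair \<open>(a, b)\<close> itself is among
  those counted, hence \<open>b - a - 1\<close>: one for it, and the rest splits at a vertex
  \<open>c\<close> into two intervals with bounds \<open>c - a - 1\<close> and
  \<open>b - c - 1\<close>.\<close>

lemma card_noncrossing:
  fixes S :: "(nat \<times> nat) set"
  assumes "a < b" and "\<And>i j. (i, j) \<in> S \<Longrightarrow> a \<le> i \<and> i + 2 \<le> j \<and> j \<le> b"
    and "\<And>i j l m. (i, l) \<in> S \<Longrightarrow> (j, m) \<in> S \<Longrightarrow> \<not> (i < j \<and> j < l \<and> l < m)"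
  shows "finite S \<and> card S \<le> b - a - 1"
  using assms
proof (induction "b - a" arbitrary: a b S rule: less_induct)
  case less
  have "S \<subseteq> {..b} \<times> {..b}" using less.prems(2) by force
  then have fin: "finite S" by (rule finite_subset) auto
  show ?case
  proof (cases "b = Suc a")
    case True
    have "S = {}" using less.prems(2) True by fastforce
    then show ?thesis by simp
  next
    case False
    then have ab: "Suc a < b" using less.prems(1) by simp
    define S' where "S' = S - {(a, b)}"
    have S': "(i, j) \<in> S' \<Longrightarrow> a \<le> i \<and> i + 2 \<le> j \<and> j \<le> b \<and> \<not> (i = a \<and> j = b)" for i j
      using less.prems(2) unfolding S'_def by auto
    have nc: "(i, l) \<in> S' \<Longrightarrow> (j, m) \<in> S' \<Longrightarrow> \<not> (i < j \<and> j < l \<and> l < m)" for i j l m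
      using less.prems(3) unfolding S'_def by auto
    have "card S' \<le> b - a - 2"
    proof (cases "\<exists>c. (a, c) \<in> S'")
      case False
      have "a < i" if "(i, j) \<in> S'" for i j using S'[OF that] False that by (cases "i = a") auto
      then have "card S' \<le> b - Suc a - 1"
        using less.hyps[of b "Suc a" S'] S' nc ab by (simp add: Suc_le_eq)
      then show ?thesis by simp
    next
      case True
      \<comment> \<open>The far end of the longest pair from \<open>a\<close> other than
        \<open>(a, b)\<close>. A pair straddling \<open>c\<close> would be a longer one starting at
        \<open>a\<close> or would cross \<open>(a, c)\<close>.\<close>
      define c where "c = Max {c. (a, c) \<in> S'}"
      have "{c. (a, c) \<in> S'} \<subseteq> {..b}" using S' by auto
      then have fc: "finite {c. (a, c) \<in> S'}" by (rule finite_subset) auto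
      then have c: "(a, c) \<in> S'" using Max_in[of "{c. (a, c) \<in> S'}"] True unfolding c_def by auto
      have cmax: "j \<le> c" if "(a, j) \<in> S'" for j unfolding c_def using fc that by (intro Max_ge) auto
      have ac: "a + 2 \<le> c" "c < b" using S'[OF c] by auto
      let ?A = "{(i, j) \<in> S'. j \<le> c}" and ?B = "{(i, j) \<in> S'. c \<le> i}"
      have "S' \<subseteq> ?A \<union> ?B"
      proof (clarify)
        fix i j assume ij: "(i, j) \<in> S'" "\<not> c \<le> i"
        show "j \<le> c"
        proof (rule ccontr)
          assume "\<not> j \<le> c"
          then have "a < i" using S'[OF ij(1)] cmax ij by (cases "i = a") auto
          then show False using nc[OF c ij(1)] ij \<open>\<not> j \<le> c\<close> by simp
        qed
      qed
      moreover have "finite ?A \<and> card ?A \<le> c - a - 1"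
        using S' nc ac by (intro less.hyps) auto
      moreover have "finite ?B \<and> card ?B \<le> b - c - 1"
        using S' nc ac by (intro less.hyps) auto
      ultimately have "card S' \<le> (c - a - 1) + (b - c - 1)"
        by (meson add_mono card_Un_le card_mono finite_UnI le_trans)
      then show ?thesis using ac by simp
    qed
    moreover have "card S \<le> card (insert (a, b) S')"
      using fin unfolding S'_def by (intro card_mono) auto
    moreover have "finite S'" using fin unfolding S'_def by simp
    then have "card (insert (a, b) S') \<le> Suc (card S')" by (simp add: card_insert_if)
    ultimately show ?thesis using fin ab by simp
  qed
qed

text \<open>The pairs of positions at distance at least 2 include the hull pair
  \<open>(0, k - 1)\<close>; removing it turns \<open>k - 2\<close> into
  \<open>k - 3\<close>.\<close>

lemma card_chords_le:
  assumes nc: "noncrossing E" and E: "\<And>e. e \<in> E \<Longrightarrow> e \<subseteq> {..<k} \<and> card e = 2"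
    and hull: "hull_pairs k \<subseteq> E" and k: "3 \<le> k"
  shows "card (E - hull_pairs k) \<le> k - 3"
proof -
  define S where "S = {(i, j). i + 2 \<le> j \<and> j < k \<and> {i, j} \<in> E}"
  have "finite S \<and> card S \<le> (k - 1) - 0 - 1"
  proof (rule card_noncrossing)
    show "\<not> (i < j \<and> j < l \<and> l < m)" if "(i, l) \<in> S" "(j, m) \<in> S" for i j l m
      using nc that unfolding S_def noncrossing_def by auto
  qed (use k in \<open>auto simp: S_def\<close>)
  then have S: "finite S" "card S \<le> k - 2" by auto
  have "{0, k - 1} \<in> E" using hull hull_pairs_iff[of 0 "k - 1" k] k by auto
  then have "(0, k - 1) \<in> S" using k by (auto simp: S_def)
  then have c: "card (S - {(0, k - 1)}) \<le> k - 3" using S by simp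
  have "E - hull_pairs k \<subseteq> (\<lambda>(i, j). {i, j}) ` (S - {(0, k - 1)})"
  proof
    fix e assume e: "e \<in> E - hull_pairs k"
    then obtain x y where xy: "e = {x, y}" "x \<noteq> y" using E by (metis DiffD1 card_2_iff)
    define i j where "i = min x y" and "j = max x y"
    have ij: "e = {i, j}" "i < j" using xy unfolding i_def j_def by (auto simp: min_def max_def)
    have "j < k" using E[of e] e ij by auto
    then have "(i, j) \<in> S - {(0, k - 1)}" using e ij hull_pairs_iff[of i j k] unfolding S_def by auto
    then show "e \<in> (\<lambda>(i, j). {i, j}) ` (S - {(0, k - 1)})" using ij by force
  qed
  then have "card (E - hull_pairs k) \<le> card (S - {(0, k - 1)})"
    using S by (intro surj_card_le) auto
  then show ?thesis using c by simp
qed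

lemma plane_hamiltonian_listed:
  assumes G: "convex_geometric_graph G" "plane G" "hamiltonian G"
  obtains vs E k where "clockwise_listing (set vs) vs" "length vs = k" "3 \<le> k"
    "G = listed_cgg vs E" "\<And>e. e \<in> E \<Longrightarrow> e \<subseteq> {..<k} \<and> card e = 2"
    "noncrossing E" "hull_pairs k \<subseteq> E"
proof -
  obtain vs where L: "clockwise_listing (verts G) vs"
    using clockwise_listing_exists G(1) unfolding convex_geometric_graph_def by blast
  then have V: "set vs = verts G" and d: "distinct vs" unfolding clockwise_listing_def by auto
  define k where "k = length vs"
  define E where "E = {e. e \<subseteq> {..<k} \<and> (!) vs ` e \<in> edges G}"
  have iv: "inj_on ((!) vs) {..<k}" using d by (intro inj_on_nth_lessThan) (auto simp: k_def)
  have Vk: "(!) vs ` {..<k} = verts G" using V by (auto simp: k_def set_conv_nth)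
  have ed: "edges G = (`) ((!) vs) ` E"
  proof (intro subset_antisym subsetI)
    fix e assume e: "e \<in> edges G"
    then have "e \<subseteq> (!) vs ` {..<k}" using edges_convex_geometric_graph[OF G(1)] Vk by auto
    then obtain e' where "e' \<subseteq> {..<k}" "e = (!) vs ` e'" by (meson subset_imageE)
    then show "e \<in> (`) ((!) vs) ` E" using e unfolding E_def by blast
  qed (auto simp: E_def)
  have E2: "e \<subseteq> {..<k} \<and> card e = 2" if "e \<in> E" for e
  proof -
    have e: "e \<subseteq> {..<k}" "(!) vs ` e \<in> edges G" using that unfolding E_def by auto
    then have "card ((!) vs ` e) = 2" using edges_convex_geometric_graph[OF G(1)] by blast
    moreover have "inj_on ((!) vs) e" using iv e by (meson inj_on_subset)
    ultimately show ?thesis using e by (simp add: card_image)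
  qed
  have nc: "noncrossing E"
    unfolding noncrossing_def
  proof (intro allI impI notI)
    fix i j l m :: nat assume o: "i < j" "j < l" "l < m" and e: "{i, l} \<in> E \<and> {j, m} \<in> E"
    have mk: "m < k" using e E2 by blast
    have "{vs ! i, vs ! l} \<in> edges G" "{vs ! j, vs ! m} \<in> edges G" using e unfolding E_def by auto
    moreover have "{vs ! i, vs ! l} \<noteq> {vs ! j, vs ! m}"
      using o mk d unfolding k_def by (auto simp: doubleton_eq_iff nth_eq_iff_index_eq)
    ultimately have "open_segment (vs ! i) (vs ! l) \<inter> open_segment (vs ! j) (vs ! m) = {}"
      using G(2) unfolding plane_def by blast
    then show False using clockwise_listing_cross[OF L o] mk unfolding k_def by simp
  qed
  obtain us where us: "3 \<le> length us" "distinct us" "set us = verts G"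
    "\<And>i. i < length us \<Longrightarrow> {us ! i, us ! (Suc i mod length us)} \<in> edges G"
    using G(3) unfolding hamiltonian_def by auto
  have lk: "length us = k" using us V d distinct_card unfolding k_def by metis
  \<comment> \<open>The Hamiltonian cycle as a permutation of positions in the clockwise
    listing.\<close>
  define h where "h = inv_into {..<k} ((!) vs) \<circ> (!) us"
  have "bij_betw ((!) us) {..<k} (verts G)"
    using inj_on_nth_lessThan[OF us(2) lk] us(3) lk by (auto simp: bij_betw_def set_conv_nth)
  moreover have "bij_betw ((!) vs) {..<k} (verts G)" using iv Vk by (simp add: bij_betw_def)
  ultimately have h: "bij_betw h {..<k} {..<k}"
    unfolding h_def by (intro bij_betw_trans[OF _ bij_betw_inv_into]) auto
  have hv: "vs ! h i = us ! i" if "i < k" for i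
  proof -
    have "us ! i \<in> (!) vs ` {..<k}" using Vk us(3) that lk by auto
    then show ?thesis unfolding h_def by (simp add: f_inv_into_f)
  qed
  have cyc: "(`) h ` hull_pairs k \<subseteq> E"
  proof
    fix e assume "e \<in> (`) h ` hull_pairs k"
    then obtain i where i: "i < k" "e = {h i, h (Suc i mod k)}" unfolding hull_pairs_def by auto
    have s: "Suc i mod k < k" using i by simp
    have "{us ! i, us ! (Suc i mod k)} \<in> edges G" using us(4) lk i by simp
    then have "(!) vs ` e \<in> edges G" using hv i s by simp
    moreover have "e \<subseteq> {..<k}" using h i s by (auto dest: bij_betwE)
    ultimately show "e \<in> E" unfolding E_def by simp
  qed
  have k: "3 \<le> k" using us lk by simp
  have GE: "G = listed_cgg vs E"
    using V ed unfolding listed_cgg_def by (cases G) simp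
  show thesis
    using that[OF _ _ k GE E2 nc hamiltonian_hull[OF nc h k cyc]] L V k_def by metis
qed

section \<open>Truncated lengths\<close>

definition circular :: "nat \<Rightarrow> nat \<Rightarrow> nat \<Rightarrow> nat" where
  "circular n T d = min T (min d (n - d))"

definition indices :: "nat \<Rightarrow> complex set \<Rightarrow> nat set" where
  "indices n e = {i \<in> {1..n}. polygon_vertex n i \<in> e}"

text \<open>Recovering the labels from the points makes the weight a function of the edge as a set.
  A one-point set gets weight 0, which covers coinciding vertices.\<close>

definition edge_weight :: "nat \<Rightarrow> nat \<Rightarrow> complex set \<Rightarrow> nat" where
  "edge_weight n T e = circular n T (Max (indices n e) - Min (indices n e))"

lemma edge_weight_le: "edge_weight n T e \<le> T"
  unfolding edge_weight_def circular_def by simp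

lemma edge_weight_pair:
  assumes "1 \<le> i" "i < j" "j \<le> n"
  shows "edge_weight n T {polygon_vertex n i, polygon_vertex n j} = circular n T (j - i)"
proof -
  have "indices n {polygon_vertex n i, polygon_vertex n j} = {i, j}"
    using assms inj_on_eq_iff[OF inj_on_polygon_vertex[of n]] unfolding indices_def by auto
  then show ?thesis using assms unfolding edge_weight_def by simp
qed

text \<open>Raising the truncation from \<open>T\<close> to \<open>T + 1\<close> adds 1 for each
  \<open>d\<close> from \<open>T + 1\<close> to \<open>n - T - 1\<close>, that is
  \<open>n - 2 T - 1\<close> times.\<close>

lemma sum_circular: "2 * T \<le> n \<Longrightarrow> (\<Sum>d\<in>{1..<n}. circular n T d) = T * (n - T)"
proof (induction T)
  case 0
  then show ?case by (simp add: circular_def)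
next
  case (Suc T)
  have "(\<Sum>d\<in>{1..<n}. circular n (Suc T) d) =
      (\<Sum>d\<in>{1..<n}. circular n T d + (if d \<in> {Suc T..n - Suc T} then 1 else 0))"
    using Suc.prems by (intro sum.cong refl) (auto simp: circular_def)
  also have "\<dots> = T * (n - T) + (\<Sum>d\<in>{1..<n}. if d \<in> {Suc T..n - Suc T} then 1 else 0)"
    using Suc by (simp add: sum.distrib)
  also have "(\<Sum>d\<in>{1..<n}. if d \<in> {Suc T..n - Suc T} then 1 else 0) = card ({1..<n} \<inter> {Suc T..n - Suc T})"
    by (subst sum.inter_restrict[symmetric]) simp_all
  also have "{1..<n} \<inter> {Suc T..n - Suc T} = {Suc T..n - Suc T}" using Suc.prems by auto
  also have "T * (n - T) + card {Suc T..n - Suc T} = Suc T * (n - Suc T)"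
  proof -
    obtain r where "n = 2 * Suc T + r" using Suc.prems nat_le_iff_add by auto
    then show ?thesis by (simp add: algebra_simps)
  qed
  finally show ?case .
qed

lemma sum_edge_weight_complete:
  assumes "2 * T \<le> n"
  shows "2 * (\<Sum>e\<in>edges (complete_cgg n). edge_weight n T e) = n * (T * (n - T))"
proof -
  let ?g = "circular n T"
  define I where "I = Sigma {1..n} (\<lambda>j. {1..<j})"
  have pv: "polygon_vertex n i = polygon_vertex n j \<longleftrightarrow> i = j" if "i \<in> {1..n}" "j \<in> {1..n}" for i j
    using inj_on_eq_iff[OF inj_on_polygon_vertex that] .
  have inj: "inj_on (\<lambda>(j, i). {polygon_vertex n i, polygon_vertex n j}) I"
    by (rule inj_onI) (auto simp: I_def doubleton_eq_iff pv)
  have img: "(\<lambda>(j, i). {polygon_vertex n i, polygon_vertex n j}) ` I = edges (complete_cgg n)"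
  proof (intro subset_antisym subsetI)
    fix e assume "e \<in> (\<lambda>(j, i). {polygon_vertex n i, polygon_vertex n j}) ` I"
    then obtain i j where "i \<in> {1..n}" "j \<in> {1..n}" "i < j" "e = {polygon_vertex n i, polygon_vertex n j}"
      by (auto simp: I_def)
    then show "e \<in> edges (complete_cgg n)"
      using pv[of i j] unfolding complete_cgg_def regular_polygon_def by auto
  next
    fix e assume "e \<in> edges (complete_cgg n)"
    then have e: "e \<subseteq> regular_polygon n" "card e = 2" by (auto simp: complete_cgg_def)
    then obtain x y where xy: "e = {x, y}" "x \<noteq> y" by (meson card_2_iff)
    then have "x \<in> polygon_vertex n ` {1..n}" "y \<in> polygon_vertex n ` {1..n}"
      using e(1) unfolding regular_polygon_def by auto
    then obtain a b where "x = polygon_vertex n a" "y = polygon_vertex n b" "a \<in> {1..n}" "b \<in> {1..n}"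
      by blast
    with xy have ab: "e = {polygon_vertex n a, polygon_vertex n b}" "a \<in> {1..n}" "b \<in> {1..n}" "a \<noteq> b"
      by auto
    show "e \<in> (\<lambda>(j, i). {polygon_vertex n i, polygon_vertex n j}) ` I"
    proof (cases "a < b")
      case True
      then show ?thesis using ab by (intro image_eqI[of _ _ "(b, a)"]) (auto simp: I_def)
    next
      case False
      then show ?thesis using ab by (intro image_eqI[of _ _ "(a, b)"]) (auto simp: I_def)
    qed
  qed
  have "(\<Sum>e\<in>edges (complete_cgg n). edge_weight n T e) =
      (\<Sum>(j, i)\<in>I. edge_weight n T {polygon_vertex n i, polygon_vertex n j})"
    unfolding img[symmetric] sum.reindex[OF inj] by (simp add: case_prod_unfold)
  also have "\<dots> = (\<Sum>(j, i)\<in>I. ?g (j - i))"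
    by (intro sum.cong refl) (auto simp: I_def edge_weight_pair)
  also have "\<dots> = (\<Sum>j\<in>{1..n}. \<Sum>i\<in>{1..<j}. ?g (j - i))"
    unfolding I_def by (subst sum.Sigma) auto
  finally have A: "(\<Sum>e\<in>edges (complete_cgg n). edge_weight n T e) = (\<Sum>j\<in>{1..n}. \<Sum>i\<in>{1..<j}. ?g (j - i))" .
  have B: "(\<Sum>i\<in>{1..<j}. ?g (j - i)) = (\<Sum>d\<in>{1..<j}. ?g d)" for j
    by (rule sum.reindex_bij_witness[of _ "\<lambda>d. j - d" "\<lambda>d. j - d"]) auto
  \<comment> \<open>The map from \<open>d\<close> to \<open>n - d\<close> preserves circular length.
    Together with reversing \<open>j\<close> it turns the lengths below \<open>j\<close> into those
    from \<open>j\<close> on, so two copies of the sum contain, for each \<open>j\<close>, all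
    lengths from 1 to \<open>n - 1\<close>.\<close>
  have C: "(\<Sum>d\<in>{1..<j}. ?g d) = (\<Sum>d\<in>{Suc n - j..<n}. ?g d)" if "j \<in> {1..n}" for j
    using that by (intro sum.reindex_bij_witness[of _ "\<lambda>d. n - d" "\<lambda>d. n - d"]) (auto simp: circular_def)
  have D: "(\<Sum>j\<in>{1..n}. \<Sum>d\<in>{1..<j}. ?g d) = (\<Sum>j\<in>{1..n}. \<Sum>d\<in>{j..<n}. ?g d)"
  proof -
    have "(\<Sum>j\<in>{1..n}. \<Sum>d\<in>{1..<j}. ?g d) = (\<Sum>j\<in>{1..n}. \<Sum>d\<in>{Suc n - j..<n}. ?g d)"
      using C by (rule sum.cong[OF refl])
    also have "\<dots> = (\<Sum>j\<in>{1..n}. \<Sum>d\<in>{j..<n}. ?g d)"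
      by (rule sum.reindex_bij_witness[of _ "\<lambda>j. Suc n - j" "\<lambda>j. Suc n - j"]) auto
    finally show ?thesis .
  qed
  have "2 * (\<Sum>j\<in>{1..n}. \<Sum>d\<in>{1..<j}. ?g d) = (\<Sum>j\<in>{1..n}. (\<Sum>d\<in>{1..<j}. ?g d) + (\<Sum>d\<in>{j..<n}. ?g d))"
    using D by (simp add: sum.distrib)
  also have "\<dots> = (\<Sum>j\<in>{1..n}. \<Sum>d\<in>{1..<n}. ?g d)"
    by (intro sum.cong refl sum.atLeastLessThan_concat) auto
  also have "\<dots> = n * (T * (n - T))" by (simp add: sum_circular[OF assms, simplified])
  finally show ?thesis unfolding A B .
qed

text \<open>The gaps between consecutive vertices of a polygon inscribed in the \<open>n\<close>-gon add up to \<open>n\<close>.\<close>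

lemma sum_edge_weight_extremal:
  assumes V: "V \<subseteq> regular_polygon n" and c: "3 \<le> card V"
  shows "(\<Sum>e\<in>extremal_pairs V. edge_weight n T e) \<le> n"
proof -
  define J where "J = {i \<in> {1..n}. polygon_vertex n i \<in> V}"
  define js where "js = sorted_list_of_set J"
  have J: "finite J" "J \<subseteq> {1..n}" unfolding J_def by auto
  have js: "sorted_wrt (<) js" "set js = J" unfolding js_def using J by auto
  have VJ: "V = polygon_vertex n ` J" using V unfolding J_def regular_polygon_def by auto
  then have Vs: "V = set (polygon_list n js)" using js by (simp add: polygon_list_def)
  have L: "clockwise_listing (set (polygon_list n js)) (polygon_list n js)"
    using js J by (intro clockwise_listing_sorted) auto
  have "card V \<le> length js" unfolding Vs by (metis card_length length_polygon_list)
  then obtain m where m: "length js = Suc m" "2 \<le> m" using c by (cases "length js") auto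
  have mono: "js ! i < js ! j" if "i < j" "j \<le> m" for i j
    using js(1) that m unfolding sorted_wrt_iff_nth_less by simp
  have rng: "1 \<le> js ! i" "js ! i \<le> n" if "i \<le> m" for i
    using J js(2) m that nth_mem[of i js] by auto
  let ?w = "\<lambda>i. edge_weight n T {polygon_list n js ! i, polygon_list n js ! (Suc i mod length js)}"
  have "(\<Sum>e\<in>extremal_pairs V. edge_weight n T e) \<le> (\<Sum>i<length js. ?w i)"
  proof -
    let ?f = "\<lambda>i. {polygon_list n js ! i, polygon_list n js ! (Suc i mod length js)}"
    have "extremal_pairs V = ?f ` {..<length js}"
      unfolding Vs using extremal_pairs_listing[OF L] m by (simp add: length_polygon_list)
    then show ?thesis using sum_image_le[of "{..<length js}" "edge_weight n T" ?f] by simp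
  qed
  also have "\<dots> = (\<Sum>i<m. ?w i) + ?w m" unfolding m by simp
  also have "(\<Sum>i<m. ?w i) \<le> (\<Sum>i<m. js ! Suc i - js ! i)"
  proof (rule sum_mono)
    fix i assume i: "i \<in> {..<m}"
    then have "?w i = circular n T (js ! Suc i - js ! i)"
      using m rng[of i] rng[of "Suc i"] mono[of i "Suc i"] by (simp add: polygon_list_def edge_weight_pair)
    then show "?w i \<le> js ! Suc i - js ! i" by (simp add: circular_def min_le_iff_disj)
  qed
  also have "(\<Sum>i<m. js ! Suc i - js ! i) = js ! m - js ! 0"
  proof -
    have "(\<Sum>i<t. js ! Suc i - js ! i) = js ! t - js ! 0" if "t \<le> m" for t
      using that
    proof (induction t)
      case (Suc t)
      have "js ! 0 \<le> js ! t" using mono[of 0 t] Suc.prems by (cases "t = 0") auto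
      then show ?case using Suc mono[of t "Suc t"] by simp
    qed simp
    then show ?thesis by simp
  qed
  also have "?w m = circular n T (js ! m - js ! 0)"
    using m rng[of 0] rng[of m] mono[of 0 m] by (simp add: polygon_list_def edge_weight_pair insert_commute)
  \<comment> \<open>The closing edge is measured the other way round, where its arc is
    \<open>n - (js ! m - js ! 0)\<close>.\<close>
  also have "js ! m - js ! 0 + circular n T (js ! m - js ! 0) \<le> n"
    using rng[of m] by (simp add: circular_def)
  finally show ?thesis by simp
qed

text \<open>Each weight is at most the arc cut off by its edge, and the three arcs add up to
  \<open>n\<close>, also when some of the points coincide.\<close>

lemma edge_weight_triangle:
  assumes "{x, y, z} \<subseteq> regular_polygon n"
  shows "edge_weight n T {x, y} + edge_weight n T {y, z} + edge_weight n T {x, z} \<le> n"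
proof -
  have *: "edge_weight n T {polygon_vertex n i, polygon_vertex n j} +
      edge_weight n T {polygon_vertex n j, polygon_vertex n l} +
      edge_weight n T {polygon_vertex n i, polygon_vertex n l} \<le> n"
    if "1 \<le> i" "i \<le> j" "j \<le> l" "l \<le> n" for i j l
  proof -
    have le: "edge_weight n T {polygon_vertex n a, polygon_vertex n b} \<le> b - a \<and>
        edge_weight n T {polygon_vertex n a, polygon_vertex n b} \<le> n - (b - a)"
      if "1 \<le> a" "a \<le> b" "b \<le> n" for a b
    proof (cases "a = b")
      case True
      have "indices n {polygon_vertex n b} = {b}"
        using that inj_on_eq_iff[OF inj_on_polygon_vertex[of n]] unfolding indices_def by auto
      then show ?thesis using True by (simp add: edge_weight_def circular_def)
    next
      case False
      then show ?thesis using that by (auto simp: edge_weight_pair circular_def min_le_iff_disj)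
    qed
    show ?thesis using le[of i j] le[of j l] le[of i l] that by linarith
  qed
  obtain i j l where ijl: "i \<in> {1..n}" "j \<in> {1..n}" "l \<in> {1..n}"
    "x = polygon_vertex n i" "y = polygon_vertex n j" "z = polygon_vertex n l"
    using assms unfolding regular_polygon_def by auto
  consider "i \<le> j \<and> j \<le> l" | "i \<le> l \<and> l \<le> j" | "j \<le> i \<and> i \<le> l" | "j \<le> l \<and> l \<le> i"
    | "l \<le> i \<and> i \<le> j" | "l \<le> j \<and> j \<le> i" by linarith
  then show ?thesis
    using ijl by cases
      (use *[of i j l] *[of i l j] *[of j i l] *[of j l i] *[of l i j] *[of l j i] in
        \<open>auto simp: insert_commute\<close>)
qed

text \<open>With \<open>n = b q\<close> and truncation at \<open>a q\<close>, the total weight is about \<open>n\<^sup>2 / 2\<close> times \<open>a (b - a) q / b\<close>,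
  while the edges of a copy have average weight at most \<open>A q\<close> divided by their number.\<close>

lemma not_convex_packable_weight:
  assumes G: "convex_geometric_graph G" "0 < card (edges G)"
    and a: "0 < a" "2 * a \<le> b"
    and big: "A * b < card (edges G) * a * (b - a)"
    and copy: "\<And>q H. subgraph H (complete_cgg (b * q)) \<Longrightarrow> convex_isomorphic H G \<Longrightarrow>
      (\<Sum>e\<in>edges H. edge_weight (b * q) (a * q) e) \<le> A * q"
  shows "\<not> convex_packable G"
proof
  assume "convex_packable G"
  let ?e = "real (card (edges G))"
  let ?r = "\<lambda>n. real (packing_number n G) * ?e / real (n choose 2)"
  have lim: "?r \<longlonglongrightarrow> 1" using \<open>convex_packable G\<close> unfolding convex_packable_def .
  have b: "0 < b" "a \<le> b" using a by auto
  have e: "0 < ?e" using G by simp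
  \<comment> \<open>In units of \<open>q\<close>: the left side is a lower bound for the average
    weight of all pairs. On the right, a fraction \<open>?r (b * q)\<close> of the pairs is covered,
    with average at most \<open>A / ?e\<close>, and every other pair weighs at most the truncation
    \<open>a\<close>.\<close>
  have ineq: "real a * (real b - real a) / real b \<le> ?r (b * q) * real A / ?e + (1 - ?r (b * q)) * real a"
    if q: "1 \<le> q" for q
  proof -
    let ?n = "b * q" and ?T = "a * q"
    let ?w = "edge_weight ?n ?T"
    obtain P where P: "packing G ?n P" "card P = packing_number ?n G"
      using packing_number_attained[OF G] by metis
    note PE = packing_edges[OF G(1) P(1)]
    define U where "U = (\<Union>H\<in>P. edges H)"
    have UE: "U \<subseteq> edges (complete_cgg ?n)" using PE(1) unfolding U_def by blast
    have finU: "finite U" using UE finite_edges_complete finite_subset by blast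
    have cU: "card U = card P * card (edges G)" unfolding U_def by (rule card_edges_packing[OF G P(1)])
    have fe: "finite (edges H)" if "H \<in> P" for H using PE(1)[OF that] finite_edges_complete finite_subset by blast
    have "sum ?w U = (\<Sum>H\<in>P. sum ?w (edges H))"
      unfolding U_def using finite_packing[OF G P(1)] fe PE(3) by (intro sum.UNION_disjoint) auto
    also have "\<dots> \<le> (\<Sum>H\<in>P. A * q)"
      using copy P(1) unfolding packing_def by (intro sum_mono) blast
    finally have s1: "sum ?w U \<le> card P * (A * q)" by simp
    have "sum ?w (edges (complete_cgg ?n) - U) \<le> (\<Sum>e\<in>edges (complete_cgg ?n) - U. ?T)"
      by (intro sum_mono edge_weight_le)
    also have "\<dots> = ((?n choose 2) - card U) * ?T"
      using card_Diff_subset[OF finU UE] card_edges_complete by simp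
    finally have s2: "sum ?w (edges (complete_cgg ?n) - U) \<le> ((?n choose 2) - card U) * ?T" .
    have s3: "sum ?w (edges (complete_cgg ?n)) = sum ?w (edges (complete_cgg ?n) - U) + sum ?w U"
      using UE finite_edges_complete by (rule sum.subset_diff)
    have Cle: "card U \<le> ?n choose 2" using card_mono[OF finite_edges_complete UE] card_edges_complete by metis
    have tot: "2 * sum ?w (edges (complete_cgg ?n)) = ?n * (?T * (?n - ?T))"
      by (rule sum_edge_weight_complete) (use a in \<open>auto simp flip: mult.assoc\<close>)
    have bq: "2 \<le> b * q" using a q mult_le_mono[of 2 b 1 q] by simp
    define C where "C = real (?n choose 2)"
    have C: "C = real ?n * (real ?n - 1) / 2" unfolding C_def
      by (cases ?n) (auto simp: choose_two field_simps real_of_nat_div)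
    have "2 \<le> real ?n" using bq by linarith
    then have C0: "0 < C" unfolding C by (intro divide_pos_pos mult_pos_pos) linarith+
    define p where "p = real (packing_number ?n G)"
    have "real (?n * (?T * (?n - ?T))) \<le> real (2 * (((?n choose 2) - card U) * ?T + card P * (A * q)))"
      unfolding tot[symmetric] s3 using s1 s2 by (intro of_nat_mono mult_le_mono2 add_mono)
    moreover have "real (?n - ?T) = (real b - real a) * real q"
      using b by (simp add: of_nat_diff algebra_simps)
    moreover have "real ((?n choose 2) - card U) = C - p * ?e"
      using Cle cU P(2) unfolding C_def p_def by (simp add: of_nat_diff)
    ultimately have main: "real b * real q * (real a * real q * ((real b - real a) * real q)) \<le>
        2 * ((C - p * ?e) * (real a * real q) + p * (real A * real q))"
      using P(2) unfolding p_def by simp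
    then have "real q * (real b * real q * (real a * (real b - real a)) * real q) \<le>
        real q * (2 * ((C - p * ?e) * real a + p * real A))"
      by (simp add: algebra_simps)
    then have main': "real b * real q * (real a * (real b - real a)) * real q \<le>
        2 * ((C - p * ?e) * real a + p * real A)" using q by simp
    have "2 * C \<le> real b * real q * (real b * real q)"
      unfolding C by (simp add: mult_left_mono)
    then have "2 * C * (real a * (real b - real a) / real b) \<le>
        real b * real q * (real b * real q) * (real a * (real b - real a) / real b)"
      using b by (intro mult_right_mono) auto
    also have "\<dots> = real b * real q * (real a * (real b - real a)) * real q" using b by simp
    also note main'
    finally have "C * (real a * (real b - real a) / real b) \<le> (C - p * ?e) * real a + p * real A" by simp
    then have "real a * (real b - real a) / real b \<le> ((C - p * ?e) * real a + p * real A) / C"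
      using C0 by (simp only: pos_le_divide_eq mult.commute)
    also have "\<dots> = p * ?e / C * real A / ?e + (1 - p * ?e / C) * real a"
      using C0 e by (simp add: field_simps)
    finally show ?thesis unfolding p_def C_def .
  qed
  \<comment> \<open>Only multiples of \<open>b\<close> are examined, where the truncation is an
    exact fraction of \<open>n\<close>; a limit along this subsequence is enough.\<close>
  have "filterlim (\<lambda>q. b * q) sequentially sequentially"
    using b by (intro filterlim_subseq strict_monoI) simp
  from filterlim_compose[OF lim this] have lim': "(\<lambda>q. ?r (b * q)) \<longlonglongrightarrow> 1" .
  have "(\<lambda>q. ?r (b * q) * real A / ?e + (1 - ?r (b * q)) * real a) \<longlonglongrightarrow> 1 * real A / ?e + (1 - 1) * real a"
    using e by (intro tendsto_intros lim') auto
  then have "real a * (real b - real a) / real b \<le> 1 * real A / ?e + (1 - 1) * real a"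
    by (rule LIMSEQ_le_const) (use ineq in blast)
  then have "real a * (real b - real a) * ?e \<le> real A * real b"
    using b e by (simp add: field_simps)
  moreover have "real (A * b) < real (card (edges G) * a * (b - a))" using big by (rule of_nat_less_iff[THEN iffD2])
  ultimately show False using b by (simp add: of_nat_diff algebra_simps)
qed

section \<open>Classification\<close>

text \<open>Hull edges are the pairs of length 1, so the isomorphism matches hull with hull and
  therefore chords with chords.\<close>

lemma extremal_copy:
  assumes L: "clockwise_listing (set vs) vs" "length vs = k" "3 \<le> k"
    and E: "\<And>e. e \<in> E \<Longrightarrow> e \<subseteq> {..<k} \<and> card e = 2" and hull: "hull_pairs k \<subseteq> E"
    and H: "convex_geometric_graph H" "convex_isomorphic H (listed_cgg vs E)"
  obtains f where "bij_betw f (verts H) (set vs)"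
    "(`) f ` extremal_pairs (verts H) = (`) ((!) vs) ` hull_pairs k"
    "(`) f ` (edges H - extremal_pairs (verts H)) = (`) ((!) vs) ` (E - hull_pairs k)"
    "extremal_pairs (verts H) \<subseteq> edges H"
    "card (edges H - extremal_pairs (verts H)) = card (E - hull_pairs k)"
proof -
  let ?G = "listed_cgg vs E" and ?X = "extremal_pairs (verts H)"
  have dv: "distinct vs" using L(1) by (simp add: clockwise_listing_def)
  have iv: "inj_on ((!) vs) {..<k}" by (rule inj_on_nth_lessThan[OF dv L(2)])
  have ivE: "inj_on ((`) ((!) vs)) E"
    using iv E by (intro inj_onI) (metis inj_on_image_eq_iff)
  have Gv: "verts ?G = set vs" and Ge: "edges ?G = (`) ((!) vs) ` E" by (simp_all add: listed_cgg_def)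
  have GE: "e \<subseteq> verts ?G \<and> card e = 2" if "e \<in> edges ?G" for e
  proof -
    have "e \<in> (`) ((!) vs) ` E" using that Ge by simp
    then obtain d where d: "d \<in> E" "e = (!) vs ` d" by auto
    then have "inj_on ((!) vs) d" using iv E by (meson inj_on_subset)
    then show ?thesis using d E[OF d(1)] L(2) Gv by (auto simp: card_image)
  qed
  obtain f where f: "bij_betw f (verts H) (verts ?G)" "bij_betw ((`) f) (edges H) (edges ?G)" and
    pl: "\<And>x y. x \<in> verts H \<Longrightarrow> y \<in> verts H \<Longrightarrow>
       pair_length (verts H) x y = pair_length (verts ?G) (f x) (f y)"
    using convex_isomorphic_edges[OF H(2) edges_convex_geometric_graph[OF H(1)] GE] by metis
  have fi: "inj_on f (verts H)" and fs: "f ` verts H = set vs" using f(1) Gv by (auto simp: bij_betw_def)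
  obtain ws where ws: "clockwise_listing (verts H) ws"
    using clockwise_listing_exists H(1) unfolding convex_geometric_graph_def by blast
  have ext: "{x, y} \<in> ?X \<longleftrightarrow> {f x, f y} \<in> extremal_pairs (set vs)"
    if xy: "x \<in> verts H" "y \<in> verts H" "x \<noteq> y" for x y
  proof -
    have "f x \<in> set vs" "f y \<in> set vs" "f x \<noteq> f y" using xy fi fs by (auto dest: inj_onD)
    from pair_length_eq_1_iff[OF L(1) this] pair_length_eq_1_iff[OF ws xy] show ?thesis
      using pl[OF xy(1,2)] Gv by simp
  qed
  have xX: "\<exists>x y. e = {x, y} \<and> x \<noteq> y \<and> x \<in> V \<and> y \<in> V"
    if mem: "e \<in> extremal_pairs V" for e V
  proof -
    obtain x y where xy: "e = {x, y}" "x \<noteq> y" and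
      "\<exists>us i. clockwise_listing V us \<and> i < length us \<and> x = us ! i \<and> y = us ! (Suc i mod length us)"
      using mem unfolding extremal_pairs_def by blast
    then obtain us i where e: "clockwise_listing V us" "i < length us"
      "x = us ! i" "y = us ! (Suc i mod length us)" by blast
    have "Suc i mod length us < length us" by (rule mod_less_divisor) (use e(2) in linarith)
    then have "x \<in> set us" "y \<in> set us" using e by auto
    then show ?thesis using e xy unfolding clockwise_listing_def by blast
  qed
  have hullG: "extremal_pairs (set vs) = (`) ((!) vs) ` hull_pairs k"
    using extremal_pairs_listed[OF L(1)] L by simp
  have im: "(`) f ` ?X = (`) ((!) vs) ` hull_pairs k"
    unfolding hullG[symmetric]
  proof (intro subset_antisym subsetI)
    fix e assume "e \<in> (`) f ` ?X"
    then obtain d where d: "d \<in> ?X" "e = f ` d" by blast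
    then obtain x y where "d = {x, y}" "x \<noteq> y" "x \<in> verts H" "y \<in> verts H" using xX by metis
    then show "e \<in> extremal_pairs (set vs)" using ext d by auto
  next
    fix e assume e: "e \<in> extremal_pairs (set vs)"
    obtain a b where ab: "e = {a, b}" "a \<noteq> b" "a \<in> f ` verts H" "b \<in> f ` verts H"
      using xX[OF e] fs by metis
    then obtain x y where xy: "x \<in> verts H" "y \<in> verts H" "a = f x" "b = f y" by blast
    then have "{x, y} \<in> ?X" using ext[of x y] ab e by auto
    moreover have "e = f ` {x, y}" using xy ab by simp
    ultimately show "e \<in> (`) f ` ?X" by blast
  qed
  have Xv: "e \<subseteq> verts H" if "e \<in> ?X" for e using xX[OF that] by blast
  have sub: "?X \<subseteq> edges H"
  proof
    fix e assume e: "e \<in> ?X"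
    then have "f ` e \<in> (`) f ` ?X" by (rule imageI)
    then have "f ` e \<in> (`) ((!) vs) ` E" unfolding im using image_mono[OF hull] by (rule rev_subsetD)
    also have "(`) ((!) vs) ` E = (`) f ` edges H" using f(2) Ge by (simp add: bij_betw_def)
    finally obtain d where d: "d \<in> edges H" "f ` e = f ` d" by (rule imageE)
    have "d \<subseteq> verts H" using edges_convex_geometric_graph[OF H(1) d(1)] by blast
    then have "e = d" using inj_on_image_eq_iff[OF fi Xv[OF e]] d(2) by blast
    then show "e \<in> edges H" using d(1) by simp
  qed
  have fe: "inj_on ((`) f) (edges H)" using f(2) by (simp add: bij_betw_def)
  have diff: "(`) f ` (edges H - ?X) = (`) ((!) vs) ` (E - hull_pairs k)"
  proof -
    have "(`) f ` (edges H - ?X) = (`) f ` edges H - (`) f ` ?X"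
      by (rule inj_on_image_set_diff[OF fe Diff_subset sub])
    also have "\<dots> = (`) ((!) vs) ` E - (`) ((!) vs) ` hull_pairs k"
      using f(2) Ge im by (simp add: bij_betw_def)
    also have "\<dots> = (`) ((!) vs) ` (E - hull_pairs k)"
      by (rule inj_on_image_set_diff[OF ivE Diff_subset hull, symmetric])
    finally show ?thesis .
  qed
  have "card (edges H - ?X) = card ((`) f ` (edges H - ?X))"
    using fe by (intro card_image[symmetric]) (rule inj_on_subset, auto)
  also have "\<dots> = card (E - hull_pairs k)"
    unfolding diff using ivE by (intro card_image) (rule inj_on_subset, auto)
  finally show thesis using that[of f] f(1) Gv im diff sub by simp
qed

text \<open>The hull costs at most \<open>n\<close> whatever the truncation, so a bound on the
  chords is all that remains to be supplied.\<close>

lemma copy_weight_split: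
  assumes L: "clockwise_listing (set vs) vs" "length vs = k" "3 \<le> k"
    and E: "\<And>e. e \<in> E \<Longrightarrow> e \<subseteq> {..<k} \<and> card e = 2" and hull: "hull_pairs k \<subseteq> E"
    and H: "subgraph H (complete_cgg n)" "convex_isomorphic H (listed_cgg vs E)"
  shows "sum (edge_weight n T) (edges H) \<le>
    n + sum (edge_weight n T) (edges H - extremal_pairs (verts H))"
proof -
  have cg: "convex_geometric_graph H" and v: "verts H \<subseteq> regular_polygon n"
    and e: "edges H \<subseteq> edges (complete_cgg n)"
    using H(1) unfolding subgraph_def complete_cgg_def by auto
  obtain f where f: "bij_betw f (verts H) (set vs)" "extremal_pairs (verts H) \<subseteq> edges H"
    using extremal_copy[OF L E hull cg H(2)] by metis
  have "card (verts H) = k"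
    using bij_betw_same_card[OF f(1)] L distinct_card unfolding clockwise_listing_def by metis
  then have "sum (edge_weight n T) (extremal_pairs (verts H)) \<le> n"
    using sum_edge_weight_extremal[OF v] L by simp
  moreover have "finite (edges H)" using e finite_edges_complete finite_subset by blast
  ultimately show ?thesis using sum.subset_diff[OF f(2), of "edge_weight n T"] by linarith
qed

lemma card_edges_listed_hull:
  assumes L: "clockwise_listing (set vs) vs" "length vs = k"
    and E: "\<And>e. e \<in> E \<Longrightarrow> e \<subseteq> {..<k} \<and> card e = 2" and hull: "hull_pairs k \<subseteq> E" "3 \<le> k"
  shows "card (edges (listed_cgg vs E)) = k + card (E - hull_pairs k)"
proof -
  have "distinct vs" using L(1) by (simp add: clockwise_listing_def)
  then have "card (edges (listed_cgg vs E)) = card E" using L E by (intro card_edges_listed) auto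
  moreover have "finite E" using E by (intro finite_subset[of E "Pow {..<k}"]) auto
  then have "card E = card (hull_pairs k) + card (E - hull_pairs k)"
    using hull finite_hull_pairs by (simp add: card_Diff_subset card_mono)
  ultimately show ?thesis using card_hull_pairs hull by simp
qed

text \<open>The bound is strongest for truncation at \<open>k n / (2 (k + m))\<close>, where \<open>m\<close> is the number of chords.\<close>

lemma not_packable_long_hull:
  assumes L: "clockwise_listing (set vs) vs" "length vs = k" "3 \<le> k"
    and E: "\<And>e. e \<in> E \<Longrightarrow> e \<subseteq> {..<k} \<and> card e = 2" and hull: "hull_pairs k \<subseteq> E"
    and G: "convex_geometric_graph (listed_cgg vs E)"
    and big: "4 * (k + card (E - hull_pairs k)) < k * k"
  shows "\<not> convex_packable (listed_cgg vs E)"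
proof -
  define m where "m = card (E - hull_pairs k)"
  define b where "b = 2 * (k + m)"
  have card: "card (edges (listed_cgg vs E)) = k + m"
    unfolding m_def by (rule card_edges_listed_hull[OF L(1,2) E hull L(3)])
  show ?thesis
  \<comment> \<open>With \<open>n = b q\<close>, the hull contributes \<open>b q\<close> and each of
    the \<open>m\<close> chords at most the truncation \<open>k q\<close>. After cancelling
    \<open>k + m\<close> and the terms \<open>2 m k\<close>, the required inequality is
    \<open>4 (k + m) < k^2\<close>.\<close>
  proof (rule not_convex_packable_weight[OF G, where a = k and b = b and A = "b + m * k"])
    show "0 < card (edges (listed_cgg vs E))" "0 < k" using card L by auto
    show "2 * k \<le> b" unfolding b_def by simp
    have "(4 * (k + m)) * (k + m) < (k * k) * (k + m)"
      using big L(3) unfolding m_def by (intro mult_strict_right_mono) auto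
    moreover have "b - k = k + 2 * m" unfolding b_def by simp
    ultimately show "(b + m * k) * b < card (edges (listed_cgg vs E)) * k * (b - k)"
      unfolding card by (simp add: b_def algebra_simps)
    fix q H assume H: "subgraph H (complete_cgg (b * q))" "convex_isomorphic H (listed_cgg vs E)"
    have cg: "convex_geometric_graph H" using H(1) unfolding subgraph_def by simp
    have "card (edges H - extremal_pairs (verts H)) = m"
      using extremal_copy[OF L E hull cg H(2)] unfolding m_def by metis
    then have "sum (edge_weight (b * q) (k * q)) (edges H - extremal_pairs (verts H)) \<le> m * (k * q)"
      using sum_mono[of "edges H - extremal_pairs (verts H)" "edge_weight (b * q) (k * q)" "\<lambda>_. k * q"]
        edge_weight_le by simp
    then show "sum (edge_weight (b * q) (k * q)) (edges H) \<le> (b + m * k) * q"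
      using copy_weight_split[OF L E hull H, of "k * q"] by (simp add: algebra_simps)
  qed
qed

text \<open>Here \<open>4 (k + m) = k^2\<close>, so the general bound just fails. Bounding the three
  chords jointly by \<open>n\<close> instead of by three truncations gains enough.\<close>

lemma not_packable_triangle:
  assumes L: "clockwise_listing (set vs) vs" "length vs = 6"
    and E: "\<And>e. e \<in> E \<Longrightarrow> e \<subseteq> {..<6} \<and> card e = 2" and hull: "hull_pairs 6 \<subseteq> E"
    and G: "convex_geometric_graph (listed_cgg vs E)"
    and tri: "E - hull_pairs 6 = {{x, y}, {y, z}, {x, z}}" "card (E - hull_pairs 6) = 3"
  shows "\<not> convex_packable (listed_cgg vs E)"
proof -
  have L3: "3 \<le> (6::nat)" by simp
  have card: "card (edges (listed_cgg vs E)) = 9"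
    using card_edges_listed_hull[OF L E hull L3] tri(2) by simp
  show ?thesis
  \<comment> \<open>Truncation at \<open>n / 2\<close> is none at all. Hull and chords together
    weigh at most \<open>2 n = 4 q\<close>, and the required inequality is
    \<open>8 < 9\<close>.\<close>
  proof (rule not_convex_packable_weight[OF G, where a = 1 and b = 2 and A = 4])
    fix q H assume H: "subgraph H (complete_cgg (2 * q))" "convex_isomorphic H (listed_cgg vs E)"
    have cg: "convex_geometric_graph H" and v: "verts H \<subseteq> regular_polygon (2 * q)"
      using H(1) unfolding subgraph_def complete_cgg_def by auto
    let ?X = "extremal_pairs (verts H)" and ?w = "edge_weight (2 * q) (1 * q)"
    obtain f where f: "bij_betw f (verts H) (set vs)"
      "(`) f ` (edges H - ?X) = (`) ((!) vs) ` (E - hull_pairs 6)"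
      using extremal_copy[OF L L3 E hull cg H(2)] by metis
    have fi: "inj_on f (verts H)" and fs: "f ` verts H = set vs" using f(1) by (auto simp: bij_betw_def)
    have lt: "x < 6" "y < 6" "z < 6" using tri(1) E by auto
    then have "vs ! x \<in> f ` verts H" "vs ! y \<in> f ` verts H" "vs ! z \<in> f ` verts H"
      using L(2) fs by auto
    then obtain x' y' z' where xyz: "x' \<in> verts H" "y' \<in> verts H" "z' \<in> verts H"
      "f x' = vs ! x" "f y' = vs ! y" "f z' = vs ! z" by (metis imageE)
    have "edges H - ?X \<subseteq> {{x', y'}, {y', z'}, {x', z'}}"
    proof
      fix e assume e: "e \<in> edges H - ?X"
      then have "f ` e \<in> (`) f ` (edges H - ?X)" by (rule imageI)
      then have "f ` e \<in> (`) ((!) vs) ` {{x, y}, {y, z}, {x, z}}" unfolding f(2) tri(1) .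
      then have im: "f ` e \<in> {f ` {x', y'}, f ` {y', z'}, f ` {x', z'}}" using xyz by simp
      have "e \<subseteq> verts H" using edges_convex_geometric_graph[OF cg] e by blast
      then have inj: "e = A" if "f ` e = f ` A" "A \<subseteq> verts H" for A
        using inj_on_image_eq_iff[OF fi] that by blast
      have sub: "{x', y'} \<subseteq> verts H" "{y', z'} \<subseteq> verts H" "{x', z'} \<subseteq> verts H" using xyz by auto
      from im show "e \<in> {{x', y'}, {y', z'}, {x', z'}}"
        using inj[OF _ sub(1)] inj[OF _ sub(2)] inj[OF _ sub(3)] by blast
    qed
    then have "sum ?w (edges H - ?X) \<le> sum ?w {{x', y'}, {y', z'}, {x', z'}}"
      by (intro sum_mono2) auto
    also have "\<dots> \<le> ?w {x', y'} + ?w {y', z'} + ?w {x', z'}"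
    proof -
      have ins: "sum ?w (insert a S) \<le> ?w a + sum ?w S" if "finite S" for a S
        using that by (simp add: sum.insert_if)
      show ?thesis using ins[of "{{y', z'}, {x', z'}}" "{x', y'}"] ins[of "{{x', z'}}" "{y', z'}"] by simp
    qed
    also have "\<dots> \<le> 2 * q" by (rule edge_weight_triangle) (use xyz v in auto)
    finally show "sum ?w (edges H) \<le> 4 * q"
      using copy_weight_split[OF L L3 E hull H, of "1 * q"] by simp
  qed (simp_all add: card)
qed

section \<open>Dihedral symmetries and enumeration of chord sets\<close>

definition chord_list :: "nat \<Rightarrow> (nat \<times> nat) list" where
  "chord_list k = filter (\<lambda>(i, j). i + 2 \<le> j \<and> (i, j) \<noteq> (0, k - 1)) (List.product [0..<k] [0..<k])"

text \<open>The dihedral group of the \<open>k\<close>-gon, each element given by its list of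
  values.\<close>

definition cyclic_symmetries :: "nat \<Rightarrow> nat list list" where
  "cyclic_symmetries k = map (\<lambda>j. rotate j [0..<k]) [0..<k] @ map (\<lambda>j. rotate j (rev [0..<k])) [0..<k]"

text \<open>An executable criterion for permuting the hull pairs: neighbours go to neighbours, in
  either direction.\<close>

definition symmetry :: "nat \<Rightarrow> nat list \<Rightarrow> bool" where
  "symmetry k p \<longleftrightarrow> length p = k \<and> distinct p \<and> (\<forall>i\<in>set [0..<k]. p ! i < k \<and>
     (p ! (Suc i mod k) = Suc (p ! i) mod k \<or> p ! i = Suc (p ! (Suc i mod k)) mod k))"

definition moved :: "nat list \<Rightarrow> nat \<times> nat \<Rightarrow> nat \<times> nat" where
  "moved p = (\<lambda>(x, y). (min (p ! x) (p ! y), max (p ! x) (p ! y)))"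

definition equivalent_chords :: "nat \<Rightarrow> (nat \<times> nat) list \<Rightarrow> (nat \<times> nat) list \<Rightarrow> bool" where
  "equivalent_chords k cs ts \<longleftrightarrow>
     (\<exists>p\<in>set (cyclic_symmetries k). set (map (moved p) cs) = set ts)"

definition chord_sets :: "nat \<Rightarrow> nat \<Rightarrow> (nat \<times> nat) list list" where
  "chord_sets k m =
     filter (\<lambda>cs. \<forall>(i, l)\<in>set cs. \<forall>(j, r)\<in>set cs. \<not> (i < j \<and> j < l \<and> l < r))
       (filter (\<lambda>cs. length cs = m) (subseqs (chord_list k)))"

lemma symmetry_hull:
  assumes s: "symmetry k p" and k: "3 \<le> k"
  shows "bij_betw ((!) p) {..<k} {..<k}" "(`) ((!) p) ` hull_pairs k = hull_pairs k"
proof -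
  have p: "length p = k" "distinct p" "\<And>i. i < k \<Longrightarrow> p ! i < k"
    "\<And>i. i < k \<Longrightarrow> p ! (Suc i mod k) = Suc (p ! i) mod k \<or> p ! i = Suc (p ! (Suc i mod k)) mod k"
    using s unfolding symmetry_def by auto
  have i: "inj_on ((!) p) {..<k}" using inj_on_nth_lessThan[OF p(2,1)] .
  moreover have "(!) p ` {..<k} = {..<k}" using p i by (intro endo_inj_surj) auto
  ultimately show "bij_betw ((!) p) {..<k} {..<k}" by (simp add: bij_betw_def)
  have "(`) ((!) p) ` hull_pairs k \<subseteq> hull_pairs k"
  proof
    fix e assume "e \<in> (`) ((!) p) ` hull_pairs k"
    then obtain i where i: "i < k" "e = {p ! i, p ! (Suc i mod k)}" unfolding hull_pairs_def by auto
    have "Suc i mod k < k" using k by simp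
    then show "e \<in> hull_pairs k"
      using p(3,4)[OF i(1)] p(3) i unfolding hull_pairs_def by (auto simp: insert_commute)
  qed
  moreover have "inj_on ((`) ((!) p)) (hull_pairs k)"
    using i hull_pairs_subset by (intro inj_onI) (metis inj_on_image_eq_iff)
  then have "card ((`) ((!) p) ` hull_pairs k) = card (hull_pairs k)" by (rule card_image)
  ultimately show "(`) ((!) p) ` hull_pairs k = hull_pairs k"
    using finite_hull_pairs by (intro card_subset_eq) auto
qed

lemma symmetry_small:
  "\<forall>k\<in>set [3..<7]. \<forall>p\<in>set (cyclic_symmetries k). symmetry k p"
  by code_simp

lemma equivalent_chords_isomorphic:
  assumes L: "clockwise_listing (set vs) vs" "length vs = k" "3 \<le> k"
    and E: "\<And>e. e \<in> E \<Longrightarrow> e \<subseteq> {..<k} \<and> card e = 2"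
    and cs: "E = hull_pairs k \<union> pair_edges cs"
    and eq: "equivalent_chords k cs ts" and k7: "k < 7"
  shows "convex_isomorphic (listed_cgg vs E) (polygon_graph k (hull_list k @ ts))"
proof -
  obtain p where p: "p \<in> set (cyclic_symmetries k)" "set (map (moved p) cs) = set ts"
    using eq unfolding equivalent_chords_def by blast
  have "k \<in> set [3..<7]" using L(3) k7 by (simp only: set_upt atLeastLessThan_iff)
  then have sym: "symmetry k p" using symmetry_small p(1) by blast
  note s = symmetry_hull[OF sym L(3)]
  have "(`) ((!) p) ` pair_edges cs = pair_edges ts"
    unfolding pair_edges_def p(2)[symmetric] set_map image_image
    by (intro image_cong refl) (auto simp: moved_def min_def max_def split: prod.splits if_splits)
  then have "(`) ((!) p) ` E = pair_edges (hull_list k @ ts)"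
    unfolding cs image_Un s(2) pair_edges_append using L(3) by (simp add: pair_edges_hull_list)
  moreover have "convex_isomorphic (listed_cgg vs E)
      (listed_cgg (polygon_list k [1..<Suc k]) ((`) ((!) p) ` E))"
    using L E s clockwise_listing_polygon[of k]
    by (intro convex_isomorphic_listed[where k = k]) (auto simp: length_polygon_list)
  ultimately show ?thesis unfolding polygon_graph_def by simp
qed

text \<open>Completeness of the enumeration: sublists of the distinct list of all chords represent
  every chord set, so finitely many cases can be evaluated.\<close>

lemma obtain_chords:
  assumes nc: "noncrossing E" and E: "\<And>e. e \<in> E \<Longrightarrow> e \<subseteq> {..<k} \<and> card e = 2"
    and hull: "hull_pairs k \<subseteq> E"
  obtains cs where "cs \<in> set (chord_sets k (card (E - hull_pairs k)))"
    "E = hull_pairs k \<union> pair_edges cs" "E - hull_pairs k = pair_edges cs"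
proof -
  define S where "S = {(i, j) \<in> set (chord_list k). {i, j} \<in> E}"
  have "S \<subseteq> set (chord_list k)" unfolding S_def by auto
  then have "S \<in> set ` set (subseqs (chord_list k))" unfolding subseqs_powset by simp
  then obtain cs where cs: "cs \<in> set (subseqs (chord_list k))" "set cs = S" by blast
  have "distinct (chord_list k)" unfolding chord_list_def by (simp add: distinct_product)
  then have d: "distinct cs" using cs(1) by (rule subseqs_distinctD[rotated])
  have mem: "(i, j) \<in> S \<longleftrightarrow> i + 2 \<le> j \<and> j < k \<and> (i, j) \<noteq> (0, k - 1) \<and> {i, j} \<in> E" for i j
    unfolding S_def chord_list_def by auto
  have chords: "E - hull_pairs k = pair_edges cs"
  proof (intro subset_antisym subsetI)
    fix e assume e: "e \<in> E - hull_pairs k"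
    then obtain x y where xy: "e = {x, y}" "x \<noteq> y" using E by (metis DiffD1 card_2_iff)
    define i j where "i = min x y" and "j = max x y"
    have ij: "e = {i, j}" "i < j" using xy unfolding i_def j_def by (auto simp: min_def max_def)
    have "j < k" using E[of e] e ij by auto
    then have "(i, j) \<in> S" using e ij hull_pairs_iff[of i j k] unfolding mem by auto
    then show "e \<in> pair_edges cs" using ij cs(2) unfolding pair_edges_def by force
  next
    fix e assume "e \<in> pair_edges cs"
    then obtain i j where "(i, j) \<in> S" "e = {i, j}" using cs(2) unfolding pair_edges_def by auto
    then show "e \<in> E - hull_pairs k" using hull_pairs_iff[of i j k] unfolding mem by auto
  qed
  have "length cs = card (E - hull_pairs k)"
    unfolding chords using d cs(2) mem by (intro card_pair_edges[symmetric]) auto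
  moreover have "\<not> (i < j \<and> j < l \<and> l < r)" if "(i, l) \<in> set cs" "(j, r) \<in> set cs" for i j l r
    using nc that cs(2) mem unfolding noncrossing_def by auto
  ultimately have "cs \<in> set (chord_sets k (card (E - hull_pairs k)))"
    using cs(1) unfolding chord_sets_def by auto
  then show thesis using that chords hull by auto
qed

text \<open>The square has two diagonals and the pentagon five triangulations, all of them fans;
  each kind is a single orbit under the symmetries.\<close>

lemma chord_sets_small:
  "\<forall>cs\<in>set (chord_sets 3 0). equivalent_chords 3 cs []"
  "\<forall>cs\<in>set (chord_sets 4 0). equivalent_chords 4 cs []"
  "\<forall>cs\<in>set (chord_sets 4 1). equivalent_chords 4 cs [(1, 3)]"
  "\<forall>cs\<in>set (chord_sets 5 2). equivalent_chords 5 cs [(0, 2), (0, 3)]"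
  by code_simp+

text \<open>The 14 triangulations of the hexagon are six zigzags, six fans and two inscribed
  triangles. The triangles are given outright because their exclusion works on the edge set
  itself.\<close>

lemma chord_sets_hexagon:
  "\<forall>cs\<in>set (chord_sets 6 3).
     equivalent_chords 6 cs [(1, 3), (1, 4), (0, 4)] \<or>
     equivalent_chords 6 cs [(1, 3), (1, 4), (1, 5)] \<or>
     set cs = set [(0, 2), (2, 4), (0, 4)] \<or> set cs = set [(1, 3), (3, 5), (1, 5)]"
  by code_simp

text \<open>With \<open>m <= k - 3\<close>, \<open>k^2 - 4 (k + m)\<close> is at least
  \<open>(k - 2) (k - 6)\<close>, which is positive from \<open>k = 7\<close> on. Four values of
  \<open>k\<close> remain to be inspected.\<close>

lemma remaining_sizes:
  fixes k m :: nat
  assumes "3 \<le> k" "m \<le> k - 3" "\<not> 4 * (k + m) < k * k"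
  shows "k = 3 \<and> m = 0 \<or> k = 4 \<and> m = 0 \<or> k = 4 \<and> m = 1 \<or> k = 5 \<and> m = 2 \<or> k = 6 \<and> m = 3"
proof -
  have "k < 7"
  proof (rule ccontr)
    assume "\<not> k < 7"
    then obtain j where "k = 7 + j" using nat_le_iff_add[of 7 k] by auto
    then show False using assms by (simp add: algebra_simps)
  qed
  then consider "k = 3" | "k = 4" | "k = 5" | "k = 6" using assms by linarith
  then show ?thesis using assms by cases auto
qed

theorem theorem4:
  "(\<forall>G. convex_geometric_graph G \<and> plane G \<and> hamiltonian G \<and>
        (\<forall>H \<in> {convex_cycle 3, convex_cycle 4, Theta1, Theta2, Theta3, Theta4}.
           \<not> convex_isomorphic G H) \<longrightarrow>
        \<not> convex_packable G) \<and>
   (\<forall>H \<in> {convex_cycle 3, convex_cycle 4, Theta1, Theta2, Theta3, Theta4}. convex_packable H)"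
proof (intro conjI allI impI)
  fix G assume asm: "convex_geometric_graph G \<and> plane G \<and> hamiltonian G \<and>
    (\<forall>H \<in> {convex_cycle 3, convex_cycle 4, Theta1, Theta2, Theta3, Theta4}. \<not> convex_isomorphic G H)"
  then have G: "convex_geometric_graph G" "plane G" "hamiltonian G" by auto
  obtain vs E k where L: "clockwise_listing (set vs) vs" "length vs = k" "3 \<le> k"
    and GE: "G = listed_cgg vs E" and E: "\<And>e. e \<in> E \<Longrightarrow> e \<subseteq> {..<k} \<and> card e = 2"
    and nc: "noncrossing E" and hull: "hull_pairs k \<subseteq> E"
    using plane_hamiltonian_listed[OF G] by metis
  define m where "m = card (E - hull_pairs k)"
  obtain cs where cs: "cs \<in> set (chord_sets k m)" "E = hull_pairs k \<union> pair_edges cs"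
    "E - hull_pairs k = pair_edges cs"
    using obtain_chords[OF nc E hull] unfolding m_def by metis
  have iso: "convex_isomorphic G (polygon_graph k (hull_list k @ ts))"
    if "equivalent_chords k cs ts" "k < 7" for ts
    unfolding GE by (rule equivalent_chords_isomorphic[OF L E cs(2) that])
  show "\<not> convex_packable G"
  proof (cases "4 * (k + m) < k * k")
    case True
    then show ?thesis
      using not_packable_long_hull[OF L E hull] G(1) unfolding GE m_def by blast
  next
    case False
    have "m \<le> k - 3" unfolding m_def by (rule card_chords_le[OF nc E hull L(3)])
    then have km: "k = 3 \<and> m = 0 \<or> k = 4 \<and> m = 0 \<or> k = 4 \<and> m = 1 \<or> k = 5 \<and> m = 2 \<or> k = 6 \<and> m = 3"
      using remaining_sizes[OF L(3) _ False] by blast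
    then have "k < 7" by auto
    then have iso: "convex_isomorphic G (polygon_graph k (hull_list k @ ts))"
      if "equivalent_chords k cs ts" for ts using iso[OF that] by simp
    from km consider "k = 3" "m = 0" | "k = 4" "m = 0" | "k = 4" "m = 1" | "k = 5" "m = 2" | "k = 6" "m = 3"
      by blast
    then show ?thesis
    proof cases
      case 1
      then have "equivalent_chords 3 cs []" using chord_sets_small(1) cs(1) by blast
      then show ?thesis using iso[of "[]"] asm 1 by (simp add: convex_cycle_eq)
    next
      case 2
      then have "equivalent_chords 4 cs []" using chord_sets_small(2) cs(1) by blast
      then show ?thesis using iso[of "[]"] asm 2 by (simp add: convex_cycle_eq)
    next
      case 3
      then have "equivalent_chords 4 cs [(1, 3)]" using chord_sets_small(3) cs(1) by blast
      then show ?thesis using iso asm 3 by (simp add: Theta_eq)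
    next
      case 4
      then have "equivalent_chords 5 cs [(0, 2), (0, 3)]" using chord_sets_small(4) cs(1) by blast
      then show ?thesis using iso asm 4 by (simp add: Theta_eq)
    next
      case 5
      \<comment> \<open>Covers both inscribed triangles, on the even and on the odd
        positions.\<close>
      have nt: "\<not> convex_packable G" if "E - hull_pairs 6 = {{x, y}, {y, z}, {x, z}}" for x y z
        unfolding GE
      proof (rule not_packable_triangle[OF L(1) _ _ _ _ that])
        show "length vs = 6" "hull_pairs 6 \<subseteq> E" "card (E - hull_pairs 6) = 3"
          using L(2) hull 5 unfolding m_def by simp_all
        show "convex_geometric_graph (listed_cgg vs E)" using G(1) unfolding GE .
        show "e \<subseteq> {..<6} \<and> card e = 2" if "e \<in> E" for e using E[OF that] 5 by simp
      qed
      consider "equivalent_chords 6 cs [(1, 3), (1, 4), (0, 4)]"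
        | "equivalent_chords 6 cs [(1, 3), (1, 4), (1, 5)]"
        | "set cs = set [(0, 2), (2, 4), (0, 4)]" | "set cs = set [(1, 3), (3, 5), (1, 5)]"
        using chord_sets_hexagon cs(1) 5 by blast
      then show ?thesis
      proof cases
        case 1
        then show ?thesis using iso asm 5 by (simp add: Theta_eq)
      next
        case 2
        then show ?thesis using iso asm 5 by (simp add: Theta_eq)
      next
        case 3
        then have "E - hull_pairs k = {{0, 2}, {2, 4}, {0, 4}}" using cs(3) by (simp add: pair_edges_def)
        then show ?thesis using 5 by (intro nt) simp
      next
        case 4
        then have "E - hull_pairs k = {{1, 3}, {3, 5}, {1, 5}}" using cs(3) by (simp add: pair_edges_def)
        then show ?thesis using 5 by (intro nt) simp
      qed
    qed
  qed
next
  show "\<forall>H \<in> {convex_cycle 3, convex_cycle 4, Theta1, Theta2, Theta3, Theta4}. convex_packable H"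
    using convex_packable_convex_cycle_3 convex_packable_convex_cycle_4 convex_packable_Theta1
      convex_packable_Theta2 convex_packable_Theta3 convex_packable_Theta4 by blast
qed

end
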